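(* Let $\mathcal D=\mathcal D(v,r;k_1,k_2)$, suppose $\gamma\le\frac{r-1}{r}$, and suppose that at least one group-affine design in $\mathcal D$ with number of groups at most $n_\gamma$ exists, so that the class $\mathcal D_E$ of all E-optimal designs in $\mathcal D$ is the class of all group-affine designs in $\mathcal D$ with at most $n_\gamma$ groups. (a) If $d_1,d_2\in\mathcal D_E$ and $t_{(d_1)}\prec t_{(d_2)}$, then $d_1$ is Schur-better than $d_2$. (b) If $d^*\in\mathcal D_E$ is uniform with exactly $n=n_\gamma$ groups, then $d^*$ is E-Schur-optimal.
   Context: Let $k_1\ge k_2\ge 2$ be integers, $v=k_1+k_2$, and $2\le r\le v-1$. A resolvable design $d$ consists of $r$ replicates, each replicate being a partition of a fixed set of $v$ treatments into two blocks, one of size $k_1$ and one of size $k_2$ (if $k_1=k_2$, one block of each replicate is designated as "the block of size $k_1$"). Let $N_d$ be the $v\times 2r$ zero-one treatment/block incidence matrix, $D_s=\mathrm{Diag}(k_1,k_2,k_1,k_2,\dots,k_1,k_2)$ the diagonal matrix of block sizes, and $C_d=rI-N_dD_s^{-1}N_d'$ the information matrix. The design is connected if $C_d$ has rank $v-1$; only connected designs are considered, and $\mathcal D(v,r;k_1,k_2)$ denotes the class of all of them. The nonzero eigenvalues of $C_d$ are $z_{d1}\le z_{d2}\le\dots\le z_{d,v-1}$. For $h\ne h'$, $\phi_{dhh'}$ is the number of treatments common to the blocks of size $k_1$ in replicates $h$ and $h'$. Put $\bar\theta=\lfloor k_1^2/(k_1+k_2)\rfloor$, $\gamma=k_1^2/(k_1+k_2)-\bar\theta\in[0,1)$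 and $n_\gamma=\lfloor 1/(1-\gamma)\rfloor$. A design $d$ is group-affine with $n$ groups of sizes $t_1\le t_2\le\dots\le t_n$ (positive integers, $\sum_i t_i=r$) if the $r$ replicates can be partitioned into $n$ groups of these sizes so that $\phi_{dhh'}=\bar\theta$ whenever $h\ne h'$ are in the same group and $\phi_{dhh'}=\bar\theta+1$ whenever $h,h'$ are in different groups. It is uniform if $t_n-t_1\le1$. For a group-affine design with $n\le n_\gamma$, $t_{(d)}\in\mathbb Z^{n_\gamma}$ is the vector of its group sizes in increasing order, padded with $n_\gamma-n$ zeros. For real vectors $x,y$ of equal length and equal entry sums, $x\prec y$ ($y$ majorizes $x$) means that for each $l$ the sum of the $l$ largest entries of $x$ is at most the sum of the $l$ largest entries of $y$. Design $d_1$ is Schur-better than design $d_2$ if $\sum_{i=1}^{v-1}f(z_{d_1i})\le\sum_{i=1}^{v-1}f(z_{d_2i})$ for every convex $f:(0,\infty)\to\mathbb R$, with strict inequality for at least one such $f$. A design is E-optimal if it maximizes $z_{d1}$ over $\mathcal D$. A design is E-Schur-optimal if it is E-optimal and minimizes $\sum_{i=1}^{v-1}f(z_{di})$ over the class of all E-optimal designs for every convex $f:(0,\infty)\to\mathbb R$.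
   Formalization: In (a), the inequality for every convex f is proved always, but the strict inequality in "Schur-better" only if t_(d1) ≠ t_(d2) and γ ≠ 1/2; when t_(d1) = t_(d2) or γ = 1/2 both designs have the same eigenvalues, so strictness is false. *)

theory Defs
  imports
    "HOL-Computational_Algebra.Polynomial"
    "HOL-Analysis.Convex"
    "HOL-Library.Disjoint_Sets"
    "Jordan_Normal_Form.Char_Poly"
    "Jordan_Normal_Form.Gauss_Jordan_Elimination"
    "Jordan_Normal_Form.DL_Rank"
begin

(* The treatments are 0, ..., k1 + k2 - 1. A replicate is the ordered pair of its two blocks;
   the first component is the block of size k1, which also fixes the designation required when
   k1 = k2. A design is the list of its replicates, indexed from 0. *)

type_synonym design = "(nat set \<times> nat set) list"

definition is_replicate :: "nat \<Rightarrow> nat \<Rightarrow> nat set \<times> nat set \<Rightarrow> bool" where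
  "is_replicate k1 k2 p \<longleftrightarrow>
     fst p \<union> snd p = {..<k1 + k2} \<and> fst p \<inter> snd p = {} \<and>
     card (fst p) = k1 \<and> card (snd p) = k2"

(* Column 2h is the block of size k1, and column 2h + 1 the block of size k2, of replicate h. *)

definition block :: "design \<Rightarrow> nat \<Rightarrow> nat set" where
  "block d j = (if even j then fst (d ! (j div 2)) else snd (d ! (j div 2)))"

definition incidence_mat :: "nat \<Rightarrow> design \<Rightarrow> real mat" where
  "incidence_mat v d = mat v (2 * length d) (\<lambda>(i, j). if i \<in> block d j then 1 else 0)"

definition block_size_mat :: "nat \<Rightarrow> nat \<Rightarrow> nat \<Rightarrow> real mat" where
  "block_size_mat k1 k2 r = mat_diag (2 * r) (\<lambda>j. if even j then real k1 else real k2)"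

definition info_mat :: "nat \<Rightarrow> nat \<Rightarrow> design \<Rightarrow> real mat" where
  "info_mat k1 k2 d =
     real (length d) \<cdot>\<^sub>m 1\<^sub>m (k1 + k2) -
     incidence_mat (k1 + k2) d * the (mat_inverse (block_size_mat k1 k2 (length d))) *
       transpose_mat (incidence_mat (k1 + k2) d)"

definition connected_design :: "nat \<Rightarrow> nat \<Rightarrow> design \<Rightarrow> bool" where
  "connected_design k1 k2 d \<longleftrightarrow>
     vec_space.rank (k1 + k2) (info_mat k1 k2 d) = k1 + k2 - 1"

definition designs :: "nat \<Rightarrow> nat \<Rightarrow> nat \<Rightarrow> design set" where
  "designs k1 k2 r =
     {d. length d = r \<and> (\<forall>p\<in>set d. is_replicate k1 k2 p) \<and> connected_design k1 k2 d}"

(* The i-th smallest nonzero eigenvalue, counted with multiplicity, for i = 1, ..., k1 + k2 - 1. *)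

definition zval :: "nat \<Rightarrow> nat \<Rightarrow> design \<Rightarrow> nat \<Rightarrow> real" where
  "zval k1 k2 d i =
     sorted_list_of_multiset
       (filter_mset (\<lambda>x. x \<noteq> 0) (proots (char_poly (info_mat k1 k2 d)))) ! (i - 1)"

definition f_sum :: "nat \<Rightarrow> nat \<Rightarrow> (real \<Rightarrow> real) \<Rightarrow> design \<Rightarrow> real" where
  "f_sum k1 k2 f d = (\<Sum>i = 1..k1 + k2 - 1. f (zval k1 k2 d i))"

(* The second conjunct fails whenever d1 and d2 have the same eigenvalues. For E-optimal designs
   that happens when their group sizes agree, and also always when gam k1 k2 = 1/2: then there are
   at most two groups, and the group sizes enter the eigenvalues only through their sum r. *)

definition schur_better :: "nat \<Rightarrow> nat \<Rightarrow> design \<Rightarrow> design \<Rightarrow> bool" where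
  "schur_better k1 k2 d1 d2 \<longleftrightarrow>
     (\<forall>f. convex_on {0<..} f \<longrightarrow> f_sum k1 k2 f d1 \<le> f_sum k1 k2 f d2) \<and>
     (\<exists>f. convex_on {0<..} f \<and> f_sum k1 k2 f d1 < f_sum k1 k2 f d2)"

definition E_optimal :: "nat \<Rightarrow> nat \<Rightarrow> nat \<Rightarrow> design \<Rightarrow> bool" where
  "E_optimal k1 k2 r d \<longleftrightarrow>
     d \<in> designs k1 k2 r \<and> (\<forall>d'\<in>designs k1 k2 r. zval k1 k2 d' 1 \<le> zval k1 k2 d 1)"

definition E_schur_optimal :: "nat \<Rightarrow> nat \<Rightarrow> nat \<Rightarrow> design \<Rightarrow> bool" where
  "E_schur_optimal k1 k2 r d \<longleftrightarrow>
     E_optimal k1 k2 r d \<and>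
     (\<forall>d'. E_optimal k1 k2 r d' \<longrightarrow>
        (\<forall>f. convex_on {0<..} f \<longrightarrow> f_sum k1 k2 f d \<le> f_sum k1 k2 f d'))"

definition phi :: "design \<Rightarrow> nat \<Rightarrow> nat \<Rightarrow> nat" where
  "phi d h h' = card (fst (d ! h) \<inter> fst (d ! h'))"

definition theta_bar :: "nat \<Rightarrow> nat \<Rightarrow> int" where
  "theta_bar k1 k2 = \<lfloor>(real k1)\<^sup>2 / (real k1 + real k2)\<rfloor>"

definition gam :: "nat \<Rightarrow> nat \<Rightarrow> real" where
  "gam k1 k2 = (real k1)\<^sup>2 / (real k1 + real k2) - of_int (theta_bar k1 k2)"

definition n_gam :: "nat \<Rightarrow> nat \<Rightarrow> nat" where
  "n_gam k1 k2 = nat \<lfloor>1 / (1 - gam k1 k2)\<rfloor>"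

definition affine_partition :: "nat \<Rightarrow> nat \<Rightarrow> design \<Rightarrow> nat set set \<Rightarrow> bool" where
  "affine_partition k1 k2 d P \<longleftrightarrow>
     partition_on {..<length d} P \<and>
     (\<forall>h<length d. \<forall>h'<length d. h \<noteq> h' \<longrightarrow>
        int (phi d h h') =
          (if \<exists>G\<in>P. h \<in> G \<and> h' \<in> G then theta_bar k1 k2 else theta_bar k1 k2 + 1))"

(* Group-affine with length ts groups, whose sizes in increasing order are ts. *)

definition group_affine :: "nat \<Rightarrow> nat \<Rightarrow> design \<Rightarrow> nat list \<Rightarrow> bool" where
  "group_affine k1 k2 d ts \<longleftrightarrow>
     sorted ts \<and> (\<exists>P. affine_partition k1 k2 d P \<and> mset ts = image_mset card (mset_set P))"

definition group_sizes :: "nat \<Rightarrow> nat \<Rightarrow> design \<Rightarrow> nat list" where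
  "group_sizes k1 k2 d = (THE ts. group_affine k1 k2 d ts)"

definition uniform_sizes :: "nat list \<Rightarrow> bool" where
  "uniform_sizes ts \<longleftrightarrow> last ts \<le> hd ts + 1"

definition t_vec :: "nat \<Rightarrow> nat \<Rightarrow> design \<Rightarrow> int list" where
  "t_vec k1 k2 d =
     replicate (n_gam k1 k2 - length (group_sizes k1 k2 d)) 0 @ map int (group_sizes k1 k2 d)"

definition majorized :: "real list \<Rightarrow> real list \<Rightarrow> bool" (infix "\<prec>\<^sub>M" 50) where
  "x \<prec>\<^sub>M y \<longleftrightarrow>
     length x = length y \<and> sum_list x = sum_list y \<and>
     (\<forall>l\<le>length x. sum_list (take l (rev (sort x))) \<le> sum_list (take l (rev (sort y))))"

lemma affine_partition_unique:
  assumes "affine_partition k1 k2 d P" "affine_partition k1 k2 d Q"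
  shows "P = Q"
proof -
  have sub: "A \<subseteq> B" if A: "affine_partition k1 k2 d A" and B: "affine_partition k1 k2 d B" for A B
  proof
    fix G assume G: "G \<in> A"
    have pA: "partition_on {..<length d} A" and pB: "partition_on {..<length d} B"
      using A B by (auto simp: affine_partition_def)
    have same: "(\<exists>G\<in>A. h \<in> G \<and> h' \<in> G) \<longleftrightarrow> (\<exists>G\<in>B. h \<in> G \<and> h' \<in> G)"
      if "h < length d" "h' < length d" for h h'
    proof (cases "h = h'")
      case True
      then show ?thesis
        using that partition_onD1[OF pA] partition_onD1[OF pB] by blast
    next
      case False
      then have "int (phi d h h') =
          (if \<exists>G\<in>A. h \<in> G \<and> h' \<in> G then theta_bar k1 k2 else theta_bar k1 k2 + 1)"
        "int (phi d h h') =
          (if \<exists>G\<in>B. h \<in> G \<and> h' \<in> G then theta_bar k1 k2 else theta_bar k1 k2 + 1)"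
        using A B that by (auto simp only: affine_partition_def)
      then show ?thesis by (auto split: if_splits)
    qed
    obtain h where h: "h \<in> G" using G partition_onD3[OF pA] by fastforce
    have hl: "h < length d" using h G partition_onD1[OF pA] by blast
    then obtain H where H: "H \<in> B" "h \<in> H" using partition_onD1[OF pB] by blast
    have uniA: "X = G" if "X \<in> A" "h \<in> X" for X
      using that h G partition_onD2[OF pA] by (auto dest: disjointD)
    have uniB: "X = H" if "X \<in> B" "h \<in> X" for X
      using that H partition_onD2[OF pB] by (auto dest: disjointD)
    have "h' \<in> G \<longleftrightarrow> h' \<in> H" for h'
    proof (cases "h' < length d")
      case True
      then show ?thesis using same[OF hl True] uniA uniB h G H by metis
    next
      case False
      then show ?thesis using G H partition_onD1[OF pA] partition_onD1[OF pB] by blast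
    qed
    then have "G = H" by blast
    then show "G \<in> B" using H by simp
  qed
  show ?thesis using sub[OF assms] sub[OF assms(2,1)] by blast
qed

lemma group_sizes_eq:
  assumes "group_affine k1 k2 d ts"
  shows "group_sizes k1 k2 d = ts"
  unfolding group_sizes_def
proof (rule the_equality, rule assms)
  fix us assume us: "group_affine k1 k2 d us"
  then have "mset us = mset ts"
    using assms affine_partition_unique unfolding group_affine_def by metis
  then show "us = ts"
    using assms us unfolding group_affine_def by (metis properties_for_sort)
qed

end

theory Submission
  imports Defs
begin

text \<open>
  On the orthogonal complement of the all-ones vector the information matrix is
  \<open>r I - c W W\<^sup>T\<close>, where \<open>c = v / (k1 k2)\<close> and column \<open>h\<close> of \<open>W\<close> is the indicator of the block of
  size \<open>k1\<close> of replicate \<open>h\<close>, shifted to have entry sum \<open>0\<close>. Since \<open>W W\<^sup>T\<close> and \<open>W\<^sup>T W\<close> have the same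
  nonzero eigenvalues, the eigenvalues of the information matrix other than the trivial \<open>0\<close> are \<open>r\<close>,
  contributed \<open>v - 1 - r\<close> times, and the numbers \<open>z + c q\<close>, where \<open>q\<close> runs through the eigenvalues of an
  \<open>r \<times> r\<close> matrix \<open>Q\<close>, the deficit matrix, and \<open>z = r - 1 - \<gamma> c\<close> depends on the parameters only
  (\<open>eigs_info_mat\<close>). The diagonal entries of \<open>Q\<close> are \<open>\<gamma>\<close>, and the entry at \<open>h \<noteq> h'\<close> is \<open>\<gamma>\<close> minus the
  integer \<open>\<phi> - \<theta>\<close>, the excess of the overlap of \<open>h\<close> and \<open>h'\<close> over \<open>\<theta> = theta_bar\<close>.

  E-optimality therefore asks for the largest possible least eigenvalue of \<open>Q\<close>. If \<open>\<gamma> \<le> (r - 1) / r\<close>, no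
  design makes \<open>Q\<close> positive definite (\<open>deficit_not_positive_definite\<close>), so \<open>z\<close> bounds the least
  eigenvalue of every design, and a design reaches \<open>z\<close> exactly when its \<open>Q\<close> is positive semidefinite.
  By integrality this is a combinatorial property: the \<open>2 \<times> 2\<close> minors force each excess to be \<open>0\<close> or \<open>1\<close>,
  the \<open>3 \<times> 3\<close> minors make "excess \<open>0\<close>" a transitive relation, so that the replicates fall into groups,
  and the quadratic form on one representative of each group bounds the number of groups by \<open>n_gam\<close>
  (\<open>psd_deficit_group_affine\<close>).

  For a group-affine design with at most \<open>m = n_gam\<close> groups, \<open>Q = E P E\<^sup>T\<close>, where \<open>E\<close> is the
  replicate/group incidence matrix with empty groups added to make \<open>m\<close> of them, and
  \<open>P = I - (1 - \<gamma>) J\<close>, with \<open>J\<close> the all-ones matrix of order \<open>m\<close>. As \<open>m (1 - \<gamma>) \<le> 1\<close>, \<open>P\<close> is positive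
  semidefinite and has a square root \<open>S = I - b J\<close>. Swapping the two factors of
  \<open>(E S) (S E\<^sup>T)\<close> shows that \<open>Q\<close> has the eigenvalues of \<open>S diag(t) S\<close>, with \<open>t\<close> the vector of group
  sizes, and \<open>r - m\<close> zeros besides (\<open>group_affine_spectrum\<close>). In particular \<open>Q\<close> is positive
  semidefinite, which completes the description of the E-optimal designs.

  The matrix \<open>S diag(t) S\<close> is linear in \<open>t\<close>, and permuting \<open>t\<close> permutes its rows and columns. The sum
  of a convex function over the eigenvalues of a symmetric matrix is a convex function of the matrix
  (\<open>convex_sum_eigenvalues_mixture_le\<close>). So the criterion is a convex symmetric function of \<open>t\<close>, and
  such a function respects majorization (\<open>size_form_schur_convex\<close>), because majorization is a chain
  of averages of a vector with a transposed copy of itself (\<open>majorization_by_transfers\<close>). This is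
  part (a). Strictness for \<open>f x = x\<^sup>2\<close> comes from the trace of \<open>(S diag(t) S)\<^sup>2\<close>, which depends on \<open>t\<close>
  through its entry sum and through \<open>(2 \<gamma> - 1) \<Sum> t\<^sub>i\<^sup>2\<close>. Part (b) follows because a vector of integers
  that differ by at most \<open>1\<close> is majorized by every integer vector of the same length and entry sum.
\<close>


section \<open>Orthogonal diagonalization of real symmetric matrices\<close>

text \<open>
  For a complex eigenvector \<open>x\<close>, the Hermitian form \<open>x\<^sup>* A x\<close> is its own conjugate and equals the
  eigenvalue times \<open>|x|\<^sup>2 > 0\<close>, so every complex eigenvalue of \<open>A\<close> is real.
\<close>
lemma symmetric_real_eigenvalue:
  fixes A :: "real mat"
  assumes A: "A \<in> carrier_mat n n" and sym: "transpose_mat A = A" and n: "n > 0"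
  shows "\<exists>l. eigenvalue A l"
proof -
  let ?C = "map_mat complex_of_real A"
  have C: "?C \<in> carrier_mat n n" using A by simp
  have "degree (char_poly ?C) = n" using degree_monic_char_poly[OF C] by simp
  then have "\<not> constant (poly (char_poly ?C))" using n constant_degree by (metis less_not_refl)
  then obtain l where l: "poly (char_poly ?C) l = 0" using fundamental_theorem_of_algebra by blast
  then have "eigenvalue ?C l" using eigenvalue_root_char_poly[OF C] by simp
  then obtain x where x: "x \<in> carrier_vec n" "x \<noteq> 0\<^sub>v n" "?C *\<^sub>v x = l \<cdot>\<^sub>v x"
    unfolding eigenvalue_def eigenvector_def using A by auto
  define N where "N = (\<Sum>i<n. (cmod (x $ i))\<^sup>2)"
  obtain i0 where i0: "i0 < n" "x $ i0 \<noteq> 0"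
    using x by (metis eq_vecI carrier_vecD index_zero_vec)
  have "0 < (cmod (x $ i0))\<^sup>2" using i0 by simp
  also have "\<dots> \<le> N" unfolding N_def using i0 by (intro member_le_sum) auto
  finally have N: "N > 0" .
  have row: "(\<Sum>j<n. of_real (A $$ (i,j)) * x $ j) = l * x $ i" if "i < n" for i
  proof -
    have "(?C *\<^sub>v x) $ i = (\<Sum>j<n. of_real (A $$ (i,j)) * x $ j)"
      using that A x(1) by (auto simp: scalar_prod_def atLeast0LessThan intro!: sum.cong)
    then show ?thesis using x that by simp
  qed
  define z where "z = (\<Sum>i<n. \<Sum>j<n. cnj (x $ i) * (of_real (A $$ (i,j)) * x $ j))"
  have "z = (\<Sum>i<n. cnj (x $ i) * (l * x $ i))"
    unfolding z_def by (intro sum.cong) (auto simp: row sum_distrib_left[symmetric])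
  also have "\<dots> = (\<Sum>i<n. l * of_real ((cmod (x $ i))\<^sup>2))"
    by (intro sum.cong refl, subst complex_norm_square, simp add: mult_ac)
  also have "\<dots> = l * of_real N"
    unfolding N_def of_real_sum sum_distrib_left ..
  finally have zl: "z = l * of_real N" .
  have Asym: "A $$ (i,j) = A $$ (j,i)" if "i < n" "j < n" for i j
    using that sym A by (metis carrier_matD index_transpose_mat(1))
  have "cnj z = (\<Sum>i<n. \<Sum>j<n. x $ i * (of_real (A $$ (i,j)) * cnj (x $ j)))"
    unfolding z_def by simp
  also have "\<dots> = (\<Sum>j<n. \<Sum>i<n. x $ i * (of_real (A $$ (i,j)) * cnj (x $ j)))"
    by (rule sum.swap)
  also have "\<dots> = z"
    unfolding z_def by (intro sum.cong refl) (auto simp: Asym mult_ac)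
  finally have "cnj z = z" .
  then have "cnj l = l" using N by (simp add: zl)
  then obtain a where a: "l = of_real a" by (metis Reals_cnj_iff Reals_cases)
  have "char_poly ?C = map_poly of_real (char_poly A)" by (rule of_real_hom.char_poly_hom[OF A])
  then have "poly (char_poly A) a = 0" using l unfolding a by simp
  then show ?thesis using eigenvalue_root_char_poly[OF A] by blast
qed

text \<open>
  \<open>H\<close> is the reflection in the hyperplane orthogonal to \<open>e\<^sub>0 - v\<close>. Being symmetric and an involution, it
  provides the orthogonal change of basis in the next induction without any completion of \<open>v\<close> to an
  orthonormal basis.
\<close>
lemma householder:
  fixes v :: "real vec"
  assumes v: "v \<in> carrier_vec n" and unit: "v \<bullet> v = 1" and n: "n > 0"
  shows "\<exists>H \<in> carrier_mat n n. transpose_mat H = H \<and> H * H = 1\<^sub>m n \<and> H *\<^sub>v unit_vec n 0 = v"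
proof -
  define x where "x i = (if i = 0 then 1 else 0) - v $ i" for i
  define s where "s = (\<Sum>i<n. x i * x i)"
  define t where "t = 2 / s"
  define H where "H = mat n n (\<lambda>(i,j). (if i = j then 1 else 0) - t * (x i * x j))"
  have H: "H \<in> carrier_mat n n" unfolding H_def by simp
  \<comment> \<open>If \<open>s = 0\<close>, then \<open>v = e\<^sub>0\<close> and \<open>t = 2 / 0 = 0\<close>, so that \<open>H\<close> is the identity.\<close>
  have tts: "t * t * s = 2 * t" unfolding t_def by simp
  have vv: "(\<Sum>i<n. v $ i * v $ i) = 1"
    using unit v by (simp add: scalar_prod_def atLeast0LessThan)
  have "s = (\<Sum>i<n. (if i = 0 then 1 - 2 * v $ i else 0) + v $ i * v $ i)"
    unfolding s_def x_def by (intro sum.cong) (auto simp: algebra_simps)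
  also have "\<dots> = 2 * x 0" using n vv by (simp add: sum.distrib x_def)
  finally have s2: "s = 2 * x 0" .
  have x0: "x i = 0" if "s = 0" "i < n" for i
    using that unfolding s_def by (simp add: sum_nonneg_eq_0_iff)
  have tx: "t * x 0 * x i = x i" if "i < n" for i
    using x0[OF _ that] s2 unfolding t_def by (cases "s = 0") auto
  have "H * H = 1\<^sub>m n"
  proof (rule eq_matI)
    fix i j assume "i < dim_row (1\<^sub>m n :: real mat)" "j < dim_col (1\<^sub>m n :: real mat)"
    then have ij: "i < n" "j < n" by auto
    have "(H * H) $$ (i,j) = (\<Sum>l<n. ((if i = l then 1 else 0) - t * (x i * x l)) *
        ((if l = j then 1 else 0) - t * (x l * x j)))"
      using ij by (simp add: H_def scalar_prod_def atLeast0LessThan)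
    also have "\<dots> = (\<Sum>l<n. (if i = l then (if i = j then 1 else 0) - t * (x i * x j) else 0)
         - (if l = j then t * (x i * x j) else 0) + t * t * x i * x j * (x l * x l))"
      by (intro sum.cong) (auto simp: algebra_simps)
    also have "\<dots> = (if i = j then 1 else 0) - 2 * t * (x i * x j) + t * t * x i * x j * s"
      using ij by (simp add: sum.distrib sum_subtractf sum_distrib_left[symmetric] s_def)
    also have "t * t * x i * x j * s = (t * t * s) * (x i * x j)" by simp
    finally show "(H * H) $$ (i,j) = 1\<^sub>m n $$ (i,j)" using ij tts by simp
  qed (auto simp: H_def)
  moreover have "transpose_mat H = H" unfolding H_def by (intro eq_matI) auto
  moreover have "H *\<^sub>v unit_vec n 0 = v"
  proof (rule eq_vecI)
    fix i assume "i < dim_vec v"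
    then have i: "i < n" using v by simp
    have "(H *\<^sub>v unit_vec n 0) $ i = H $$ (i, 0)"
      using i n H by (simp add: scalar_prod_def unit_vec_def sum.delta' if_distrib cong: if_cong)
    also have "\<dots> = (if i = 0 then 1 else 0) - t * x 0 * x i"
      using i n by (simp add: H_def mult_ac)
    also have "\<dots> = v $ i" unfolding tx[OF i] by (simp add: x_def)
    finally show "(H *\<^sub>v unit_vec n 0) $ i = v $ i" .
  qed (use v H in auto)
  ultimately show ?thesis using H by blast
qed

text \<open>
  Induction on the order: after a reflection that moves \<open>e\<^sub>0\<close> to a unit eigenvector, the first column of
  the matrix is a multiple of \<open>e\<^sub>0\<close>; by symmetry so is the first row, and the remaining block is
  symmetric.
\<close>
lemma orthogonal_diagonalization:
  fixes A :: "real mat"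
  assumes "A \<in> carrier_mat n n" and "transpose_mat A = A"
  shows "\<exists>P f. similar_mat_wit A (mat_diag n f) P (transpose_mat P)"
  using assms
proof (induction n arbitrary: A)
  case 0
  then have "A = mat_diag 0 (\<lambda>_. 0)" by (intro eq_matI) (auto simp: mat_diag_def)
  moreover have "similar_mat_wit A A (1\<^sub>m 0) (1\<^sub>m 0)" using 0 by (intro similar_mat_wit_refl)
  moreover have "(1\<^sub>m 0 :: real mat) = transpose_mat (1\<^sub>m 0)" by simp
  ultimately show ?case by metis
next
  case (Suc m)
  let ?n = "Suc m"
  note A = Suc.prems(1) and sym = Suc.prems(2)
  obtain e where "eigenvalue A e" using symmetric_real_eigenvalue[OF A sym] by auto
  then obtain w where w: "w \<in> carrier_vec ?n" "w \<noteq> 0\<^sub>v ?n" "A *\<^sub>v w = e \<cdot>\<^sub>v w"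
    unfolding eigenvalue_def eigenvector_def using A by auto
  have ww: "w \<bullet> w > 0"
  proof -
    obtain i0 where i0: "i0 < ?n" "w $ i0 \<noteq> 0"
      using w by (metis eq_vecI carrier_vecD index_zero_vec)
    have "0 < w $ i0 * w $ i0" using i0 by (metis not_real_square_gt_zero)
    also have "\<dots> \<le> (\<Sum>i = 0..<?n. w $ i * w $ i)"
      using i0 by (intro member_le_sum[of i0 _ "\<lambda>i. w $ i * w $ i"]) auto
    finally show ?thesis using w(1) by (simp add: scalar_prod_def)
  qed
  define v where "v = (1 / sqrt (w \<bullet> w)) \<cdot>\<^sub>v w"
  have v: "v \<in> carrier_vec ?n" unfolding v_def using w by simp
  have vv: "v \<bullet> v = 1" unfolding v_def using w(1) ww by simp
  have Av: "A *\<^sub>v v = e \<cdot>\<^sub>v v"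
    unfolding v_def using mult_mat_vec[OF A w(1)] w(3) by (simp add: smult_smult_assoc mult.commute)
  obtain H where H: "H \<in> carrier_mat ?n ?n" and HT: "transpose_mat H = H"
    and HH: "H * H = 1\<^sub>m ?n" and Hv: "H *\<^sub>v unit_vec ?n 0 = v"
    using householder[OF v vv] by auto
  define B where "B = H * A * H"
  have B: "B \<in> carrier_mat ?n ?n" unfolding B_def using H A by simp
  have "transpose_mat (H * A * H) = transpose_mat H * transpose_mat (H * A)"
    using H A by (intro transpose_mult[of _ ?n ?n]) auto
  also have "transpose_mat (H * A) = transpose_mat A * transpose_mat H"
    using H A by (intro transpose_mult[of _ ?n ?n]) auto
  finally have BT: "transpose_mat B = B" unfolding B_def using HT sym H A by simp
  have HBH: "H * B * H = A"
  proof -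
    have "H * B * H = (H * H) * A * (H * H)"
      unfolding B_def using H A by (simp add: assoc_mult_mat[of _ ?n ?n _ ?n _ ?n])
    then show ?thesis using A by (simp add: HH)
  qed
  have simAB: "similar_mat_wit A B H H"
    by (rule similar_mat_witI[of _ _ ?n]) (use HH HBH H A B in auto)
  have "H *\<^sub>v v = (H * H) *\<^sub>v unit_vec ?n 0"
    using H Hv by (simp add: assoc_mult_mat_vec[of _ ?n ?n _ ?n])
  then have Hv': "H *\<^sub>v v = unit_vec ?n 0" by (simp add: HH)
  have "B *\<^sub>v unit_vec ?n 0 = H *\<^sub>v (A *\<^sub>v (H *\<^sub>v unit_vec ?n 0))"
    unfolding B_def using H A by (simp add: assoc_mult_mat_vec[of _ ?n ?n _ ?n])
  also have "\<dots> = e \<cdot>\<^sub>v unit_vec ?n 0"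
    unfolding Hv Av using H v Hv' by (simp add: mult_mat_vec[of _ ?n ?n])
  finally have Be: "B *\<^sub>v unit_vec ?n 0 = e \<cdot>\<^sub>v unit_vec ?n 0" .
  have B0: "B $$ (i, 0) = (if i = 0 then e else 0)" if "i < ?n" for i
  proof -
    have "B $$ (i, 0) = (B *\<^sub>v unit_vec ?n 0) $ i"
      using that B by (simp add: scalar_prod_def unit_vec_def sum.delta' if_distrib cong: if_cong)
    then show ?thesis using that unfolding Be by simp
  qed
  have B0': "B $$ (0, i) = (if i = 0 then e else 0)" if "i < ?n" for i
    using B0[OF that] BT B that by (metis carrier_matD index_transpose_mat(1) zero_less_Suc)
  define A1 where "A1 = mat 1 1 (\<lambda>_. e)"
  define A3 where "A3 = mat m m (\<lambda>(i,j). B $$ (Suc i, Suc j))"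
  have A1: "A1 \<in> carrier_mat 1 1" and A3: "A3 \<in> carrier_mat m m" unfolding A1_def A3_def by auto
  have Bblock: "B = four_block_mat A1 (0\<^sub>m 1 m) (0\<^sub>m m 1) A3"
    using B B0 B0' by (intro eq_matI) (auto simp: A1_def A3_def less_Suc_eq_0_disj)
  have "transpose_mat A3 = A3"
    unfolding A3_def using BT B
    by (intro eq_matI) (auto, metis Suc_less_eq carrier_matD index_transpose_mat(1))
  from Suc.IH[OF A3 this] obtain P f where P: "similar_mat_wit A3 (mat_diag m f) P (transpose_mat P)"
    by blast
  note wit = similar_mat_witD2[OF A3 P]
  define g where "g k = (case k of 0 \<Rightarrow> e | Suc k \<Rightarrow> f k)" for k
  define P' where "P' = four_block_mat (1\<^sub>m 1) (0\<^sub>m 1 m) (0\<^sub>m m 1) P"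
  have P': "P' \<in> carrier_mat ?n ?n" unfolding P'_def using wit(6) by auto
  have P'T: "transpose_mat P' = four_block_mat (1\<^sub>m 1) (0\<^sub>m 1 m) (0\<^sub>m m 1) (transpose_mat P)"
    unfolding P'_def using wit(6) by (subst transpose_four_block_mat[of _ 1 1 _ m _ m]) auto
  have diag: "mat_diag ?n g = four_block_mat A1 (0\<^sub>m 1 m) (0\<^sub>m m 1) (mat_diag m f)"
    by (intro eq_matI) (auto simp: A1_def mat_diag_def g_def less_Suc_eq_0_disj)
  have "similar_mat_wit B (mat_diag ?n g) P' (transpose_mat P')"
    unfolding Bblock diag P'T unfolding P'_def
    by (rule similar_mat_wit_four_block[OF similar_mat_wit_refl[OF A1] P _ _ A1 A3])
      (use wit in auto)
  then have "similar_mat_wit A (mat_diag ?n g) (H * P') (transpose_mat P' * H)"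
    by (rule similar_mat_wit_trans[OF simAB])
  moreover have "transpose_mat P' * H = transpose_mat (H * P')"
    using H P' HT by (simp add: transpose_mult[of _ ?n ?n])
  ultimately show ?case by metis
qed

text \<open>
  Real square matrices are treated below as functions on index pairs, restricted to indices less than
  \<open>n\<close>: then an argument can permute indices, use a parametrized family of matrices, or vary the order,
  and everything is a computation with finite sums. The vector \<open>u k\<close> is the eigenvector of \<open>q k\<close>.
\<close>
definition spectral_decomp ::
  "nat \<Rightarrow> (nat \<Rightarrow> nat \<Rightarrow> real) \<Rightarrow> (nat \<Rightarrow> nat \<Rightarrow> real) \<Rightarrow> (nat \<Rightarrow> real) \<Rightarrow> bool" where
  "spectral_decomp n A u q \<longleftrightarrow>
     (\<forall>k<n. \<forall>l<n. (\<Sum>i<n. u k i * u l i) = (if k = l then 1 else 0)) \<and>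
     (\<forall>i<n. \<forall>j<n. A i j = (\<Sum>k<n. q k * (u k i * u k j)))"

text \<open>
  The roots are counted with algebraic multiplicity, as in the definition of the eigenvalues of a
  design; the characteristic polynomial is what can be compared between matrices of different orders.
\<close>
definition eigs :: "nat \<Rightarrow> (nat \<Rightarrow> nat \<Rightarrow> real) \<Rightarrow> real multiset" where
  "eigs n A = proots (char_poly (mat n n (\<lambda>(i,j). A i j)))"

lemma eigs_cong:
  assumes "\<And>i j. i < n \<Longrightarrow> j < n \<Longrightarrow> A i j = B i j"
  shows "eigs n A = eigs n B"
proof -
  have "mat n n (\<lambda>(i,j). A i j) = mat n n (\<lambda>(i,j). B i j)" using assms by (intro eq_matI) auto
  then show ?thesis unfolding eigs_def by simp
qed

lemma spectral_theorem:
  assumes sym: "\<And>i j. i < n \<Longrightarrow> j < n \<Longrightarrow> A i j = A j i"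
  obtains u q where "spectral_decomp n A u q"
proof -
  let ?A = "mat n n (\<lambda>(i,j). A i j)"
  have A: "?A \<in> carrier_mat n n" by simp
  have "transpose_mat ?A = ?A" using sym by (intro eq_matI) auto
  then obtain P f where "similar_mat_wit ?A (mat_diag n f) P (transpose_mat P)"
    using orthogonal_diagonalization[OF A] by blast
  note P = similar_mat_witD2[OF A this]
  have PT: "transpose_mat P * P = 1\<^sub>m n" and cP: "P \<in> carrier_mat n n" using P by auto
  have AP: "?A = P * mat_diag n f * transpose_mat P" by (rule P(3))
  have "spectral_decomp n A (\<lambda>k i. P $$ (i,k)) f"
    unfolding spectral_decomp_def
  proof (intro conjI allI impI)
    fix k l assume kl: "k < n" "l < n"
    have "(transpose_mat P * P) $$ (k,l) = (\<Sum>i<n. P $$ (i,k) * P $$ (i,l))"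
      using kl cP by (auto simp: scalar_prod_def atLeast0LessThan)
    then show "(\<Sum>i<n. P $$ (i,k) * P $$ (i,l)) = (if k = l then 1 else 0)"
      using kl unfolding PT by simp
  next
    fix i j assume ij: "i < n" "j < n"
    have "A i j = ?A $$ (i,j)" using ij by simp
    also have "\<dots> = (\<Sum>k<n. f k * (P $$ (i,k) * P $$ (j,k)))"
      unfolding AP mat_diag_mult_right[OF cP]
      using ij cP by (auto simp: scalar_prod_def atLeast0LessThan mult_ac intro!: sum.cong)
    finally show "A i j = (\<Sum>k<n. f k * (P $$ (i,k) * P $$ (j,k)))" .
  qed
  then show thesis by (rule that)
qed

lemma spectral_decomp_orthonormal:
  assumes "spectral_decomp n A u q" "k < n" "l < n"
  shows "(\<Sum>i<n. u k i * u l i) = (if k = l then 1 else 0)"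
  using assms unfolding spectral_decomp_def by blast

lemma spectral_decomp_similar:
  assumes "spectral_decomp n A u q"
  shows "similar_mat_wit (mat n n (\<lambda>(i,j). A i j)) (mat_diag n q)
    (mat n n (\<lambda>(i,k). u k i)) (transpose_mat (mat n n (\<lambda>(i,k). u k i)))"
proof -
  let ?U = "mat n n (\<lambda>(i,k). u k i)"
  have U: "?U \<in> carrier_mat n n" by simp
  have TU: "transpose_mat ?U * ?U = 1\<^sub>m n"
    using spectral_decomp_orthonormal[OF assms]
    by (intro eq_matI) (auto simp: scalar_prod_def atLeast0LessThan)
  have UT: "?U * transpose_mat ?U = 1\<^sub>m n"
    by (rule mat_mult_left_right_inverse[OF _ U TU]) simp
  have "mat n n (\<lambda>(i,j). A i j) = ?U * mat_diag n q * transpose_mat ?U"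
    unfolding mat_diag_mult_right[OF U]
    using assms by (intro eq_matI)
      (auto simp: spectral_decomp_def scalar_prod_def atLeast0LessThan mult_ac intro!: sum.cong)
  then show ?thesis by (intro similar_mat_witI[OF UT TU]) auto
qed

text \<open>
  The rows of a square matrix are orthonormal as soon as the columns are.
\<close>
lemma spectral_decomp_complete:
  assumes "spectral_decomp n A u q" "i < n" "j < n"
  shows "(\<Sum>k<n. u k i * u k j) = (if i = j then 1 else 0)"
proof -
  let ?U = "mat n n (\<lambda>(i,k). u k i)"
  have "?U * transpose_mat ?U = 1\<^sub>m n"
    using similar_mat_witD2(1)[OF _ spectral_decomp_similar[OF assms(1)], of n n] by simp
  moreover have "(?U * transpose_mat ?U) $$ (i,j) = (\<Sum>k<n. u k i * u k j)"
    using assms(2,3) by (simp add: scalar_prod_def atLeast0LessThan)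
  ultimately show ?thesis using assms(2,3) by simp
qed

lemma proots_linear_factors: "proots (\<Prod>a\<leftarrow>xs. [:- a, 1:]) = mset (xs :: real list)"
proof (induction xs)
  case (Cons a xs)
  have "(\<Prod>a\<leftarrow>xs. [:- a, 1:]) \<noteq> 0" by (auto simp: prod_list_zero_iff)
  then show ?case using Cons by (simp add: proots_mult del: mult_pCons_left)
qed simp

lemma eigs_spectral_decomp:
  assumes "spectral_decomp n A u q"
  shows "eigs n A = image_mset q (mset_set {..<n})"
proof -
  have "char_poly (mat n n (\<lambda>(i,j). A i j)) = char_poly (mat_diag n q)"
    using spectral_decomp_similar[OF assms] by (intro char_poly_similar) (auto simp: similar_mat_def)
  also have "\<dots> = (\<Prod>a\<leftarrow>diag_mat (mat_diag n q). [:- a, 1:])"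
    by (rule char_poly_upper_triangular[of _ n]) (auto simp: mat_diag_def)
  also have "diag_mat (mat_diag n q) = map q [0..<n]"
    by (auto simp: diag_mat_def mat_diag_def intro!: map_cong)
  finally have cp: "char_poly (mat n n (\<lambda>(i,j). A i j)) = (\<Prod>a\<leftarrow>map q [0..<n]. [:- a, 1:])" .
  show ?thesis unfolding eigs_def cp proots_linear_factors
    by (simp add: mset_map atLeast0LessThan)
qed

lemma quadratic_form_weighted_squares:
  fixes y :: "nat \<Rightarrow> real"
  shows "(\<Sum>i<n. \<Sum>j<n. y i * (\<Sum>k<N. q k * (w k i * w k j)) * y j) = (\<Sum>k<N. q k * (\<Sum>i<n. w k i * y i)\<^sup>2)"
proof -
  have "(\<Sum>i<n. \<Sum>j<n. y i * (\<Sum>k<N. q k * (w k i * w k j)) * y j) =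
      (\<Sum>i<n. \<Sum>j<n. \<Sum>k<N. q k * ((w k i * y i) * (w k j * y j)))"
    by (intro sum.cong refl)
      (auto simp: sum_distrib_left sum_distrib_right mult_ac intro!: sum.cong)
  also have "\<dots> = (\<Sum>i<n. \<Sum>k<N. \<Sum>j<n. q k * ((w k i * y i) * (w k j * y j)))"
    by (intro sum.cong refl sum.swap)
  also have "\<dots> = (\<Sum>k<N. \<Sum>i<n. \<Sum>j<n. q k * ((w k i * y i) * (w k j * y j)))"
    by (rule sum.swap)
  also have "\<dots> = (\<Sum>k<N. q k * (\<Sum>i<n. w k i * y i)\<^sup>2)"
    by (intro sum.cong refl) (simp only: power2_eq_square sum_product sum_distrib_left[symmetric])
  finally show ?thesis .
qed

lemma spectral_decomp_quadratic_form:
  assumes "spectral_decomp n A u q"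
  shows "(\<Sum>i<n. \<Sum>j<n. y i * A i j * y j) = (\<Sum>k<n. q k * (\<Sum>i<n. u k i * y i)\<^sup>2)"
  using assms unfolding quadratic_form_weighted_squares[symmetric]
  by (auto simp: spectral_decomp_def intro!: sum.cong)

lemma spectral_decomp_eigenvalue:
  assumes "spectral_decomp n A u q" "k < n"
  shows "q k = (\<Sum>i<n. \<Sum>j<n. u k i * A i j * u k j)"
proof -
  have "(\<Sum>i<n. \<Sum>j<n. u k i * A i j * u k j) = (\<Sum>l<n. q l * (\<Sum>i<n. u l i * u k i)\<^sup>2)"
    by (rule spectral_decomp_quadratic_form[OF assms(1)])
  also have "\<dots> = (\<Sum>l<n. if l = k then q l else 0)"
    by (intro sum.cong) (auto simp: spectral_decomp_orthonormal[OF assms(1)] assms(2))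
  finally show ?thesis using assms(2) by simp
qed

lemma spectral_decomp_affine:
  assumes "spectral_decomp n A u q"
  shows "spectral_decomp n (\<lambda>i j. a * (if i = j then 1 else 0) + b * A i j) u (\<lambda>k. a + b * q k)"
  unfolding spectral_decomp_def
proof (intro conjI allI impI)
  fix i j assume ij: "i < n" "j < n"
  have "(\<Sum>k<n. (a + b * q k) * (u k i * u k j)) =
      a * (\<Sum>k<n. u k i * u k j) + b * (\<Sum>k<n. q k * (u k i * u k j))"
    by (simp add: sum_distrib_left sum.distrib algebra_simps)
  then show "a * (if i = j then 1 else 0) + b * A i j = (\<Sum>k<n. (a + b * q k) * (u k i * u k j))"
    using assms ij by (simp add: spectral_decomp_complete[OF assms] spectral_decomp_def)
qed (use spectral_decomp_orthonormal[OF assms] in auto)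

lemma spectral_decomp_permute:
  assumes "spectral_decomp n A u q" and \<sigma>: "bij_betw \<sigma> {..<n} {..<n}"
  shows "spectral_decomp n (\<lambda>i j. A (\<sigma> i) (\<sigma> j)) (\<lambda>k i. u k (\<sigma> i)) q"
  unfolding spectral_decomp_def
proof (intro conjI allI impI)
  fix k l assume "k < n" "l < n"
  then show "(\<Sum>i<n. u k (\<sigma> i) * u l (\<sigma> i)) = (if k = l then 1 else 0)"
    using sum.reindex_bij_betw[OF \<sigma>, of "\<lambda>i. u k i * u l i"] spectral_decomp_orthonormal[OF assms(1)]
    by simp
next
  fix i j assume "i < n" "j < n"
  moreover have "\<sigma> x < n" if "x < n" for x using \<sigma> that by (auto simp: bij_betw_def)
  ultimately show "A (\<sigma> i) (\<sigma> j) = (\<Sum>k<n. q k * (u k (\<sigma> i) * u k (\<sigma> j)))"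
    using assms(1) by (auto simp: spectral_decomp_def)
qed

lemma spectral_decomp_trace:
  assumes "spectral_decomp n A u q"
  shows "(\<Sum>k<n. q k) = (\<Sum>i<n. A i i)"
proof -
  have "(\<Sum>i<n. A i i) = (\<Sum>i<n. \<Sum>k<n. q k * (u k i * u k i))"
    using assms by (auto simp: spectral_decomp_def intro!: sum.cong)
  also have "\<dots> = (\<Sum>k<n. \<Sum>i<n. q k * (u k i * u k i))" by (rule sum.swap)
  also have "\<dots> = (\<Sum>k<n. q k)"
    by (intro sum.cong) (auto simp: sum_distrib_left[symmetric] spectral_decomp_orthonormal[OF assms])
  finally show ?thesis ..
qed

lemma spectral_decomp_square:
  assumes "spectral_decomp n A u q"
  shows "spectral_decomp n (\<lambda>i j. \<Sum>l<n. A i l * A l j) u (\<lambda>k. (q k)\<^sup>2)"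
  unfolding spectral_decomp_def
proof (intro conjI allI impI)
  fix i j assume ij: "i < n" "j < n"
  have "(\<Sum>l<n. A i l * A l j) =
      (\<Sum>l<n. \<Sum>k<n. \<Sum>h<n. (q k * (u k i * u k l)) * (q h * (u h l * u h j)))"
    using assms ij by (intro sum.cong) (auto simp: spectral_decomp_def sum_product)
  also have "\<dots> = (\<Sum>k<n. \<Sum>l<n. \<Sum>h<n. (q k * (u k i * u k l)) * (q h * (u h l * u h j)))"
    by (rule sum.swap)
  also have "\<dots> = (\<Sum>k<n. \<Sum>h<n. \<Sum>l<n. (q k * (u k i * u k l)) * (q h * (u h l * u h j)))"
    by (intro sum.cong refl sum.swap)
  also have "\<dots> = (\<Sum>k<n. \<Sum>h<n. (q k * q h * u k i * u h j) * (\<Sum>l<n. u k l * u h l))"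
    by (simp add: sum_distrib_left mult_ac)
  also have "\<dots> = (\<Sum>k<n. (q k)\<^sup>2 * (u k i * u k j))"
    by (intro sum.cong refl)
      (simp add: spectral_decomp_orthonormal[OF assms] if_distrib power2_eq_square mult_ac cong: if_cong)
  finally show "(\<Sum>l<n. A i l * A l j) = (\<Sum>k<n. (q k)\<^sup>2 * (u k i * u k j))" .
qed (use spectral_decomp_orthonormal[OF assms] in auto)

text \<open>
  The case of the identity matrix in \<open>spectral_decomp_quadratic_form\<close>.
\<close>
lemma spectral_decomp_parseval:
  assumes "spectral_decomp n A u q"
  shows "(\<Sum>k<n. (\<Sum>i<n. u k i * y i)\<^sup>2) = (\<Sum>i<n. (y i)\<^sup>2)"
proof -
  have "(\<Sum>k<n. (1 + 0 * q k) * (\<Sum>i<n. u k i * y i)\<^sup>2) =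
      (\<Sum>i<n. \<Sum>j<n. y i * (1 * (if i = j then 1 else 0) + 0 * A i j) * y j)"
    by (rule spectral_decomp_quadratic_form[OF spectral_decomp_affine[OF assms], symmetric])
  also have "\<dots> = (\<Sum>i<n. \<Sum>j<n. if i = j then (y i)\<^sup>2 else 0)"
    by (intro sum.cong refl) (auto simp: power2_eq_square)
  also have "\<dots> = (\<Sum>i<n. (y i)\<^sup>2)" by simp
  finally show ?thesis by simp
qed

section \<open>Swapping the factors of a matrix product, and rank\<close>

text \<open>
  Both sides equal \<open>X\<^sup>m det M\<close> for the block matrix \<open>M\<close> with blocks \<open>X I\<close>, \<open>A\<close>, \<open>B\<close>, \<open>I\<close>: multiplying
  \<open>M\<close> by a block triangular matrix, from the right or from the left, clears its lower left block and
  leaves \<open>X I - A B\<close> or \<open>X I - B A\<close> on the diagonal.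
\<close>
lemma char_poly_mult_swap:
  fixes A B :: "'a :: idom mat"
  assumes A: "A \<in> carrier_mat n m" and B: "B \<in> carrier_mat m n"
  shows "[:0, 1:] ^ m * char_poly (A * B) = [:0, 1:] ^ n * char_poly (B * A)"
proof -
  define X :: "'a poly" where "X = [:0, 1:]"
  let ?c = "map_mat (\<lambda>a::'a. [:a:])" and ?m = "map_mat (\<lambda>a::'a. [:-a:])"
  \<comment> \<open>\<open>L\<close> clears \<open>M\<close> from the right, \<open>R\<close> from the left.\<close>
  define M where "M = four_block_mat (X \<cdot>\<^sub>m 1\<^sub>m n) (?c A) (?c B) (1\<^sub>m m)"
  define L where "L = four_block_mat (1\<^sub>m n) (0\<^sub>m n m) (?m B) (1\<^sub>m m)"
  define R where "R = four_block_mat (1\<^sub>m n) (0\<^sub>m n m) (?m B) (X \<cdot>\<^sub>m 1\<^sub>m m)"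
  have cA: "?c A \<in> carrier_mat n m" and cB: "?c B \<in> carrier_mat m n"
    and mB: "?m B \<in> carrier_mat m n" using A B by auto
  have M: "M \<in> carrier_mat (n + m) (n + m)" and L: "L \<in> carrier_mat (n + m) (n + m)"
    and R: "R \<in> carrier_mat (n + m) (n + m)"
    unfolding M_def L_def R_def by (auto intro!: four_block_carrier_mat)
  have AB: "?c A * ?m B = ?m (A * B)"
    using map_poly_mult(3)[OF A B, of "-1"] by simp
  have BA: "?m B * ?c A = ?m (B * A)"
    using map_poly_mult(2)[OF B A, of "-1"] by simp
  have "M * L = four_block_mat (char_poly_matrix (A * B)) (?c A) (0\<^sub>m m n) (1\<^sub>m m)"
    unfolding M_def L_def
    by (subst mult_four_block_mat[of _ n n _ m _ m _ _ n _ m])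
      (use A B cA cB mB in \<open>auto simp: AB char_poly_matrix_def X_def intro!: eq_matI\<close>)
  then have "det (M * L) = char_poly (A * B)"
    unfolding char_poly_def using cA A B
    by (simp add: det_four_block_mat_lower_left_zero[of _ n _ m])
  moreover have "det L = 1"
    unfolding L_def using mB by (simp add: det_four_block_mat_upper_right_zero[of _ n _ m])
  ultimately have 1: "det M = char_poly (A * B)"
    using det_mult[OF M L] by simp
  have "R * M = four_block_mat (X \<cdot>\<^sub>m 1\<^sub>m n) (?c A) (0\<^sub>m m n) (char_poly_matrix (B * A))"
    unfolding M_def R_def
    by (subst mult_four_block_mat[of _ n n _ m _ m _ _ n _ m])
      (use A B cA cB mB in \<open>auto simp: BA char_poly_matrix_def X_def
        mult_smult_distrib[of _ m n] mult_smult_assoc_mat[of _ m m] intro!: eq_matI\<close>)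
  then have "det (R * M) = X ^ n * char_poly (B * A)"
    unfolding char_poly_def using cA A B
    by (simp add: det_four_block_mat_lower_left_zero[of _ n _ m] det_smult)
  moreover have "det R = X ^ m"
    unfolding R_def using mB by (simp add: det_four_block_mat_upper_right_zero[of _ n _ m] det_smult)
  ultimately have "X ^ m * det M = X ^ n * char_poly (B * A)"
    using det_mult[OF R M] by simp
  then show ?thesis unfolding 1 X_def .
qed

lemma char_poly_nonzero: "A \<in> carrier_mat n n \<Longrightarrow> char_poly A \<noteq> 0"
  using degree_monic_char_poly by force

lemma eigs_mult_swap:
  assumes "m \<le> n"
  shows "eigs n (\<lambda>i j. \<Sum>k<m. Z i k * Y k j) =
    eigs m (\<lambda>k l. \<Sum>i<n. Y k i * Z i l) + replicate_mset (n - m) 0"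
proof -
  let ?Z = "mat n m (\<lambda>(i,k). Z i k)" and ?Y = "mat m n (\<lambda>(k,i). Y k i)"
  let ?X = "[:0, 1:] :: real poly"
  have ZY: "?Z * ?Y = mat n n (\<lambda>(i,j). \<Sum>k<m. Z i k * Y k j)"
    by (intro eq_matI) (auto simp: scalar_prod_def atLeast0LessThan)
  have YZ: "?Y * ?Z = mat m m (\<lambda>(k,l). \<Sum>i<n. Y k i * Z i l)"
    by (intro eq_matI) (auto simp: scalar_prod_def atLeast0LessThan)
  have nz: "char_poly (?Z * ?Y) \<noteq> 0" "char_poly (?Y * ?Z) \<noteq> 0"
    by (auto intro!: char_poly_nonzero)
  have pX: "proots (?X ^ k) = replicate_mset k 0" for k
    using proots_linear_factor[of "0::real"] by (simp add: proots_power repeat_mset_replicate_mset del: proots_linear_factor)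
  have "proots (?X ^ m * char_poly (?Z * ?Y)) = proots (?X ^ n * char_poly (?Y * ?Z))"
    by (subst char_poly_mult_swap[of _ n m]) auto
  then have "replicate_mset m 0 + proots (char_poly (?Z * ?Y)) =
      replicate_mset n 0 + proots (char_poly (?Y * ?Z))"
    using nz by (simp add: proots_mult pX)
  moreover have "replicate_mset n (0::real) = replicate_mset m 0 + replicate_mset (n - m) 0"
    using assms by (intro multiset_eqI) auto
  ultimately show ?thesis unfolding eigs_def ZY YZ by (simp add: add.commute)
qed

text \<open>
  The decomposition writes the matrix as a sum of one matrix of rank at most \<open>1\<close> for each nonzero
  eigenvalue.
\<close>
lemma rank_spectral_decomp_le:
  assumes "spectral_decomp n A u q"
  shows "vec_space.rank n (mat n n (\<lambda>(i,j). A i j)) \<le> card {k. k < n \<and> q k \<noteq> 0}"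
proof -
  interpret vec_space "TYPE(real)" n .
  have *: "rank (mat n n (\<lambda>(i,j). \<Sum>k\<in>K. q k * (u k i * u k j))) \<le> card K" if "finite K" for K
    using that
  proof (induction K)
    case empty
    have zero: "mat n n (\<lambda>(i,j). \<Sum>k\<in>{}. q k * (u k i * u k j)) = 0\<^sub>m n n"
      by (intro eq_matI) auto
    show ?case unfolding zero by (simp add: rank_0I)
  next
    case (insert k K)
    let ?B = "mat n n (\<lambda>(i,j). \<Sum>k\<in>K. q k * (u k i * u k j))"
    let ?C = "mat n n (\<lambda>(i,j). q k * (u k i * u k j))"
    have "mat n n (\<lambda>(i,j). \<Sum>k\<in>insert k K. q k * (u k i * u k j)) = ?C + ?B"
      using insert by (intro eq_matI) auto
    moreover have "rank ?C \<le> 1"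
      by (rule rank_le_1_product_entries[of _ n "\<lambda>i. q k * u k i" "u k"]) auto
    ultimately show ?case using rank_subadditive[of ?C n ?B] insert by simp
  qed
  have "mat n n (\<lambda>(i,j). A i j) =
      mat n n (\<lambda>(i,j). \<Sum>k\<in>{k. k < n \<and> q k \<noteq> 0}. q k * (u k i * u k j))"
    using assms by (intro eq_matI)
      (auto simp: spectral_decomp_def intro!: sum.mono_neutral_right)
  then show ?thesis using *[of "{k. k < n \<and> q k \<noteq> 0}"] by simp
qed

section \<open>Positive semidefinite matrices\<close>

definition psd :: "nat \<Rightarrow> (nat \<Rightarrow> nat \<Rightarrow> real) \<Rightarrow> bool" where
  "psd n A \<longleftrightarrow> (\<forall>y. 0 \<le> (\<Sum>i<n. \<Sum>j<n. y i * A i j * y j))"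

lemma psd_iff_eigenvalues_nonneg:
  assumes "spectral_decomp n A u q"
  shows "psd n A \<longleftrightarrow> (\<forall>k<n. 0 \<le> q k)"
proof
  assume "psd n A"
  then show "\<forall>k<n. 0 \<le> q k" by (simp add: psd_def spectral_decomp_eigenvalue[OF assms])
next
  assume "\<forall>k<n. 0 \<le> q k"
  then show "psd n A"
    unfolding psd_def spectral_decomp_quadratic_form[OF assms] by (auto intro!: sum_nonneg)
qed

lemma quadratic_form_restrict:
  fixes A :: "nat \<Rightarrow> nat \<Rightarrow> real"
  assumes T: "T \<subseteq> {..<n}" and y: "\<And>i. i < n \<Longrightarrow> i \<notin> T \<Longrightarrow> y i = 0"
  shows "(\<Sum>i<n. \<Sum>j<n. y i * A i j * y j) = (\<Sum>i\<in>T. \<Sum>j\<in>T. y i * A i j * y j)"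
proof -
  have "(\<Sum>j<n. y i * A i j * y j) = (\<Sum>j\<in>T. y i * A i j * y j)" for i
    using T y by (intro sum.mono_neutral_right) auto
  moreover have "(\<Sum>i<n. \<Sum>j\<in>T. y i * A i j * y j) = (\<Sum>i\<in>T. \<Sum>j\<in>T. y i * A i j * y j)"
    using T y by (intro sum.mono_neutral_right) auto
  ultimately show ?thesis by simp
qed

lemma psd_minor:
  assumes "psd n A" "finite T" "T \<subseteq> {..<n}"
  shows "0 \<le> (\<Sum>i\<in>T. \<Sum>j\<in>T. y i * A i j * y j)"
proof -
  let ?y = "\<lambda>i. if i \<in> T then y i else 0"
  have "0 \<le> (\<Sum>i<n. \<Sum>j<n. ?y i * A i j * ?y j)"
    by (rule assms(1)[unfolded psd_def, rule_format])
  also have "\<dots> = (\<Sum>i\<in>T. \<Sum>j\<in>T. ?y i * A i j * ?y j)"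
    using assms by (intro quadratic_form_restrict) auto
  finally show ?thesis by (simp cong: sum.cong)
qed

section \<open>Convex functions of eigenvalues\<close>

text \<open>
  The diagonal entries \<open>\<delta> k\<close> of \<open>X\<close> in the orthonormal basis \<open>u\<close> are \<open>\<Sum>\<^sub>l c k l * \<xi> l\<close> with
  \<open>c k l\<close> the squared inner product of \<open>u k\<close> with the \<open>l\<close>-th eigenvector of \<open>X\<close>. By Parseval's identity,
  applied to both bases, \<open>c\<close> is doubly stochastic, and Jensen's inequality gives the claim.
\<close>
lemma convex_sum_diagonal_le:
  fixes f :: "real \<Rightarrow> real"
  assumes u: "spectral_decomp n A u \<alpha>" and X: "spectral_decomp n X p \<xi>"
    and f: "convex_on I f" and \<xi>: "\<And>k. k < n \<Longrightarrow> \<xi> k \<in> I"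
  defines "\<delta> \<equiv> \<lambda>k. \<Sum>i<n. \<Sum>j<n. u k i * X i j * u k j"
  shows "(\<Sum>k<n. f (\<delta> k)) \<le> (\<Sum>k<n. f (\<xi> k))" and "\<And>k. k < n \<Longrightarrow> \<delta> k \<in> I"
proof -
  define c where "c k l = (\<Sum>i<n. p l i * u k i)\<^sup>2" for k l
  have \<delta>: "\<delta> k = (\<Sum>l<n. c k l * \<xi> l)" for k
    unfolding \<delta>_def c_def spectral_decomp_quadratic_form[OF X, of "u k"] by (simp add: mult.commute)
  have row: "(\<Sum>l<n. c k l) = 1" if "k < n" for k
    unfolding c_def spectral_decomp_parseval[OF X]
    using spectral_decomp_orthonormal[OF u that that] by (simp add: power2_eq_square)
  have col: "(\<Sum>k<n. c k l) = 1" if "l < n" for l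
  proof -
    have "(\<Sum>k<n. c k l) = (\<Sum>k<n. (\<Sum>i<n. u k i * p l i)\<^sup>2)"
      unfolding c_def by (simp add: mult.commute)
    then show ?thesis
      unfolding spectral_decomp_parseval[OF u]
      using spectral_decomp_orthonormal[OF X that that] by (simp add: power2_eq_square)
  qed
  have c0: "c k l \<ge> 0" for k l unfolding c_def by simp
  show "\<delta> k \<in> I" if k: "k < n" for k
    using convex_sum[of "{..<n}" I "c k" \<xi>] row[OF k] c0 \<xi> convex_on_imp_convex[OF f]
    unfolding \<delta> by simp
  have "f (\<delta> k) \<le> (\<Sum>l<n. c k l * f (\<xi> l))" if k: "k < n" for k
    using convex_on_sum[of "{..<n}" I f "c k" \<xi>] k row[OF k] c0 \<xi> f
    unfolding \<delta> by auto
  then have "(\<Sum>k<n. f (\<delta> k)) \<le> (\<Sum>k<n. \<Sum>l<n. c k l * f (\<xi> l))" by (intro sum_mono) auto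
  also have "\<dots> = (\<Sum>l<n. \<Sum>k<n. c k l * f (\<xi> l))" by (rule sum.swap)
  also have "\<dots> = (\<Sum>l<n. f (\<xi> l))"
    by (intro sum.cong) (auto simp: sum_distrib_right[symmetric] col)
  finally show "(\<Sum>k<n. f (\<delta> k)) \<le> (\<Sum>k<n. f (\<xi> k))" .
qed

text \<open>
  In an eigenbasis of \<open>A\<close>, every eigenvalue of \<open>A\<close> is the mixture of the corresponding diagonal entries
  of \<open>X\<close> and \<open>Y\<close>, to which the preceding inequality applies.
\<close>
lemma convex_sum_eigenvalues_mixture_le:
  fixes f :: "real \<Rightarrow> real"
  assumes A: "spectral_decomp n A u \<alpha>" and X: "spectral_decomp n X p \<xi>" and Y: "spectral_decomp n Y w \<eta>"
    and mix: "\<And>i j. i < n \<Longrightarrow> j < n \<Longrightarrow> A i j = (1 - s) * X i j + s * Y i j"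
    and s: "0 \<le> s" "s \<le> 1" and f: "convex_on I f"
    and \<xi>: "\<And>k. k < n \<Longrightarrow> \<xi> k \<in> I" and \<eta>: "\<And>k. k < n \<Longrightarrow> \<eta> k \<in> I"
  shows "(\<Sum>k<n. f (\<alpha> k)) \<le> (1 - s) * (\<Sum>k<n. f (\<xi> k)) + s * (\<Sum>k<n. f (\<eta> k))"
proof -
  define x where "x k = (\<Sum>i<n. \<Sum>j<n. u k i * X i j * u k j)" for k
  define y where "y k = (\<Sum>i<n. \<Sum>j<n. u k i * Y i j * u k j)" for k
  note px = convex_sum_diagonal_le[OF A X f \<xi>, folded x_def]
  note py = convex_sum_diagonal_le[OF A Y f \<eta>, folded y_def]
  have \<alpha>: "\<alpha> k = (1 - s) * x k + s * y k" if "k < n" for k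
  proof -
    have "\<alpha> k = (\<Sum>i<n. \<Sum>j<n. u k i * A i j * u k j)"
      by (rule spectral_decomp_eigenvalue[OF A that])
    also have "\<dots> = (\<Sum>i<n. \<Sum>j<n. (1 - s) * (u k i * X i j * u k j) + s * (u k i * Y i j * u k j))"
      by (intro sum.cong) (auto simp: mix algebra_simps)
    also have "\<dots> = (1 - s) * x k + s * y k"
      unfolding x_def y_def by (simp add: sum.distrib sum_distrib_left)
    finally show ?thesis .
  qed
  have "f (\<alpha> k) \<le> (1 - s) * f (x k) + s * f (y k)" if k: "k < n" for k
    unfolding \<alpha>[OF k] using convex_onD[OF f, of s "x k" "y k"] s px(2)[OF _ k] py(2)[OF _ k] by simp
  then have "(\<Sum>k<n. f (\<alpha> k)) \<le> (\<Sum>k<n. (1 - s) * f (x k) + s * f (y k))"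
    by (intro sum_mono) auto
  also have "\<dots> = (1 - s) * (\<Sum>k<n. f (x k)) + s * (\<Sum>k<n. f (y k))"
    by (simp add: sum.distrib sum_distrib_left)
  also have "\<dots> \<le> (1 - s) * (\<Sum>k<n. f (\<xi> k)) + s * (\<Sum>k<n. f (\<eta> k))"
    using px(1) py(1) s by (intro add_mono mult_left_mono) auto
  finally show ?thesis .
qed

section \<open>Majorization\<close>

text \<open>
  Here \<open>x\<close> is increasing, and \<open>y\<close> majorizes \<open>x\<close> in the form of prefix sums: sums of the smallest entries
  are at most those of \<open>x\<close>. If \<open>x \<noteq> y\<close>, let \<open>j\<close> be the first index with \<open>x j < y j\<close>. Before \<open>j\<close> all entries
  of \<open>y\<close> are at most those of \<open>x\<close>, and some \<open>i < j\<close> has \<open>y i < x i\<close>. Moving \<open>\<delta>\<close>, the smaller of the two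
  gaps, from \<open>y j\<close> to \<open>y i\<close> mixes \<open>y\<close> with its transposed copy, keeps the prefix sums at most those
  of \<open>x\<close>, and makes \<open>y\<close> agree with \<open>x\<close> at one more index at least. Stating majorization by prefix sums of
  \<open>y\<close> in the given order lets the induction go on without sorting the new vector.
\<close>
lemma majorization_by_transfers:
  fixes F :: "(nat \<Rightarrow> real) \<Rightarrow> real"
  assumes transfer: "\<And>y i j s. (\<forall>k<m. 0 \<le> y k) \<Longrightarrow> i < m \<Longrightarrow> j < m \<Longrightarrow> 0 \<le> s \<Longrightarrow> s \<le> 1 \<Longrightarrow>
      F (\<lambda>k. (1 - s) * y k + s * y (transpose i j k)) \<le> F y"
    and x: "\<And>i j. i \<le> j \<Longrightarrow> j < m \<Longrightarrow> x i \<le> x j"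
    and y: "\<And>k. k < m \<Longrightarrow> 0 \<le> y k" and tail: "\<And>k. m \<le> k \<Longrightarrow> x k = y k"
    and prefix: "\<And>l. l \<le> m \<Longrightarrow> (\<Sum>k<l. y k) \<le> (\<Sum>k<l. x k)"
    and total: "(\<Sum>k<m. y k) = (\<Sum>k<m. x k)"
  shows "F x \<le> F y"
  using y tail prefix total
proof (induction "card {k. k < m \<and> x k \<noteq> y k}" arbitrary: y rule: less_induct)
  case (less y)
  show ?case
  proof (cases "\<forall>k<m. x k = y k")
    case True
    then have "x = y" using less.prems(2) by (intro ext) (metis not_le)
    then show ?thesis by simp
  next
    case False
    have "\<exists>j<m. x j < y j"
    proof (rule ccontr)
      assume "\<not> ?thesis"
      then have le: "\<And>k. k < m \<Longrightarrow> y k \<le> x k" by force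
      obtain k where "k < m" "x k \<noteq> y k" using False by blast
      then have "(\<Sum>k<m. y k) < (\<Sum>k<m. x k)"
        using le by (intro sum_strict_mono_ex1) (auto intro!: bexI[of _ k] simp: less_le)
      then show False using less.prems(4) by simp
    qed
    define j where "j = (LEAST j. j < m \<and> x j < y j)"
    have j: "j < m" "x j < y j"
      using LeastI_ex[OF \<open>\<exists>j<m. x j < y j\<close>] unfolding j_def by auto
    have before: "y k \<le> x k" if "k < j" for k
    proof (rule ccontr)
      assume "\<not> y k \<le> x k"
      then have "k < m \<and> x k < y k" using that j by auto
      then show False using not_less_Least[OF that[unfolded j_def]] by blast
    qed
    obtain i where i: "i < j" "y i < x i"
    proof (rule ccontr)
      assume "\<not> thesis"
      then have "(\<Sum>k<j. x k) \<le> (\<Sum>k<j. y k)" using that by (intro sum_mono) (metis lessThan_iff not_le)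
      then have "(\<Sum>k<Suc j. x k) < (\<Sum>k<Suc j. y k)" using j by simp
      then show False using less.prems(3)[of "Suc j"] j by simp
    qed
    \<comment> \<open>The gap \<open>y j - y i\<close> exceeds \<open>\<delta>\<close> since \<open>y i < x i \<le> x j < y j\<close>, so \<open>s \<le> 1\<close>.\<close>
    define \<delta> where "\<delta> = min (x i - y i) (y j - x j)"
    define s where "s = \<delta> / (y j - y i)"
    define z where "z k = (1 - s) * y k + s * y (transpose i j k)" for k
    have gap: "y i < y j" "\<delta> > 0" "\<delta> \<le> y j - y i"
      using i j x[of i j] unfolding \<delta>_def by auto
    have s: "0 \<le> s" "s \<le> 1" "s * (y j - y i) = \<delta>" unfolding s_def using gap by auto
    have z: "z k = (if k = i then y i + \<delta> else if k = j then y j - \<delta> else y k)" for k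
      using s(3) i unfolding z_def by (auto simp: algebra_simps)
    have "F z \<le> F y"
      unfolding z_def using transfer[of y i j s] less.prems(1) i j s by auto
    moreover have "F x \<le> F z"
    proof (rule less.hyps)
      have "{k. k < m \<and> x k \<noteq> z k} \<subset> {k. k < m \<and> x k \<noteq> y k}"
      proof
        show "{k. k < m \<and> x k \<noteq> z k} \<subseteq> {k. k < m \<and> x k \<noteq> y k}"
          using i j unfolding z by auto
        have "x i = z i \<or> x j = z j" using i unfolding z \<delta>_def by (auto simp: min_def)
        then obtain l where "l \<in> {i, j}" "x l = z l" by blast
        then have "l \<in> {k. k < m \<and> x k \<noteq> y k}" "l \<notin> {k. k < m \<and> x k \<noteq> z k}"
          using i j by auto
        then show "{k. k < m \<and> x k \<noteq> z k} \<noteq> {k. k < m \<and> x k \<noteq> y k}" by blast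
      qed
      then show "card {k. k < m \<and> x k \<noteq> z k} < card {k. k < m \<and> x k \<noteq> y k}"
        by (intro psubset_card_mono) auto
    next
      fix k assume k: "k < m"
      have "0 \<le> y (transpose i j k)" using less.prems(1) i j k by (auto simp: transpose_def)
      then show "0 \<le> z k" unfolding z_def using s less.prems(1)[OF k] by simp
    next
      fix k assume "m \<le> k"
      then show "x k = z k" using less.prems(2) i j unfolding z by auto
    next
      have sumz: "(\<Sum>k<l. z k) = (\<Sum>k<l. y k) + (if i < l then \<delta> else 0) - (if j < l then \<delta> else 0)" for l
      proof -
        have "(\<Sum>k<l. z k) = (\<Sum>k<l. y k + (if k = i then \<delta> else 0) - (if k = j then \<delta> else 0))"
          using i by (intro sum.cong) (auto simp: z)
        then show ?thesis by (simp add: sum.distrib sum_subtractf)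
      qed
      show "(\<Sum>k<m. z k) = (\<Sum>k<m. x k)" using sumz[of m] less.prems(4) i j by simp
      fix l assume l: "l \<le> m"
      show "(\<Sum>k<l. z k) \<le> (\<Sum>k<l. x k)"
      proof (cases "i < l \<and> l \<le> j")
        case True
        have "x i - y i \<le> (\<Sum>k<l. x k - y k)"
          using True before by (intro member_le_sum) auto
        then show ?thesis using True sumz[of l] unfolding \<delta>_def by (simp add: sum_subtractf)
      next
        case False
        then show ?thesis using sumz[of l] less.prems(3)[OF l] i by auto
      qed
    qed
    ultimately show ?thesis by simp
  qed
qed

text \<open>
  The midpoint \<open>z\<close> of \<open>x\<close> and \<open>y\<close> still majorizes \<open>x\<close>, so \<open>\<Sum> x\<^sup>2 \<le> \<Sum> z\<^sup>2\<close>; strict convexity of the square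
  makes \<open>\<Sum> z\<^sup>2\<close> smaller than the mean of \<open>\<Sum> x\<^sup>2\<close> and \<open>\<Sum> y\<^sup>2\<close>.
\<close>
lemma sum_squares_less_of_majorized:
  fixes x y :: "nat \<Rightarrow> real"
  assumes x: "\<And>i j. i \<le> j \<Longrightarrow> j < m \<Longrightarrow> x i \<le> x j" "\<And>k. k < m \<Longrightarrow> 0 \<le> x k"
    and y: "\<And>k. k < m \<Longrightarrow> 0 \<le> y k" and tail: "\<And>k. m \<le> k \<Longrightarrow> x k = y k"
    and prefix: "\<And>l. l \<le> m \<Longrightarrow> (\<Sum>k<l. y k) \<le> (\<Sum>k<l. x k)"
    and total: "(\<Sum>k<m. y k) = (\<Sum>k<m. x k)"
    and ne: "x \<noteq> y"
  shows "(\<Sum>k<m. (x k)\<^sup>2) < (\<Sum>k<m. (y k)\<^sup>2)"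
proof -
  define z where "z k = (x k + y k) / 2" for k
  have half: "(\<Sum>k<l. z k) = ((\<Sum>k<l. x k) + (\<Sum>k<l. y k)) / 2" for l
    unfolding z_def by (simp add: sum.distrib flip: sum_divide_distrib)
  have "(\<Sum>k<m. (x k)\<^sup>2) \<le> (\<Sum>k<m. (z k)\<^sup>2)"
  proof (rule majorization_by_transfers[where F = "\<lambda>y. \<Sum>k<m. (y k)\<^sup>2" and x = x and m = m])
    fix y :: "nat \<Rightarrow> real" and i j and s :: real
    assume ij: "i < m" "j < m" and s: "0 \<le> s" "s \<le> 1"
    let ?t = "transpose i j"
    have "bij_betw ?t {..<m} {..<m}"
      using ij by (intro bij_betw_byWitness[where f' = ?t]) (auto simp: transpose_def)
    then have sym: "(\<Sum>k<m. (y (?t k))\<^sup>2) = (\<Sum>k<m. (y k)\<^sup>2)"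
      by (rule sum.reindex_bij_betw)
    have "((1 - s) * y k + s * y (?t k))\<^sup>2 \<le> (1 - s) * (y k)\<^sup>2 + s * (y (?t k))\<^sup>2" for k
    proof -
      have "(1 - s) * (y k)\<^sup>2 + s * (y (?t k))\<^sup>2 - ((1 - s) * y k + s * y (?t k))\<^sup>2
          = s * (1 - s) * (y k - y (?t k))\<^sup>2"
        by (simp add: power2_eq_square algebra_simps)
      also have "\<dots> \<ge> 0" using s by simp
      finally show ?thesis by simp
    qed
    then have "(\<Sum>k<m. ((1 - s) * y k + s * y (?t k))\<^sup>2) \<le>
        (\<Sum>k<m. (1 - s) * (y k)\<^sup>2 + s * (y (?t k))\<^sup>2)"
      by (rule sum_mono)
    also have "\<dots> = (1 - s) * (\<Sum>k<m. (y k)\<^sup>2) + s * (\<Sum>k<m. (y (?t k))\<^sup>2)"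
      by (simp add: sum.distrib sum_distrib_left)
    also have "\<dots> = (\<Sum>k<m. (y k)\<^sup>2)" unfolding sym by (simp add: algebra_simps)
    finally show "(\<Sum>k<m. ((1 - s) * y k + s * y (?t k))\<^sup>2) \<le> (\<Sum>k<m. (y k)\<^sup>2)" .
  next
    show "(\<Sum>k<l. z k) \<le> (\<Sum>k<l. x k)" if "l \<le> m" for l
      using prefix[OF that] half[of l] by simp
    show "(\<Sum>k<m. z k) = (\<Sum>k<m. x k)" using total half[of m] by simp
    show "\<And>k. k < m \<Longrightarrow> 0 \<le> z k" using x(2) y by (simp add: z_def)
    show "\<And>k. m \<le> k \<Longrightarrow> x k = z k" using tail by (simp add: z_def)
  qed (rule x(1))
  moreover have "(\<Sum>k<m. (z k)\<^sup>2) < (\<Sum>k<m. ((x k)\<^sup>2 + (y k)\<^sup>2) / 2)"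
  proof (rule sum_strict_mono_ex1)
    have eq: "((x k)\<^sup>2 + (y k)\<^sup>2) / 2 - (z k)\<^sup>2 = ((x k - y k) / 2)\<^sup>2" for k
      unfolding z_def by (simp add: power2_eq_square field_simps)
    show "\<forall>k\<in>{..<m}. (z k)\<^sup>2 \<le> ((x k)\<^sup>2 + (y k)\<^sup>2) / 2"
      using eq by (metis diff_ge_0_iff_ge zero_le_power2)
    obtain k where "x k \<noteq> y k" using ne by auto
    then have "k < m" "((x k - y k) / 2)\<^sup>2 > 0" using tail by (auto simp: not_le[symmetric])
    then show "\<exists>k\<in>{..<m}. (z k)\<^sup>2 < ((x k)\<^sup>2 + (y k)\<^sup>2) / 2"
      using eq[of k] by (intro bexI[of _ k]) (linarith, simp)
  qed simp
  moreover have "(\<Sum>k<m. ((x k)\<^sup>2 + (y k)\<^sup>2) / 2) = ((\<Sum>k<m. (x k)\<^sup>2) + (\<Sum>k<m. (y k)\<^sup>2)) / 2"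
    by (simp add: sum.distrib flip: sum_divide_distrib)
  ultimately show ?thesis by simp
qed

text \<open>
  If a prefix of \<open>y\<close> had the larger sum, some \<open>y i\<close> in it would be at least \<open>x i + 1 \<ge> x 0 + 1\<close>; then all
  later entries of \<open>y\<close>, being at least \<open>x 0 + 1\<close>, would be at least those of \<open>x\<close>, and the total of \<open>y\<close>
  would be the larger one.
\<close>
lemma uniform_prefix_sums_largest:
  fixes x y :: "nat \<Rightarrow> int"
  assumes x: "\<And>i. i < m \<Longrightarrow> x 0 \<le> x i" "\<And>i. i < m \<Longrightarrow> x i \<le> x 0 + 1"
    and y: "\<And>i j. i \<le> j \<Longrightarrow> j < m \<Longrightarrow> y i \<le> y j"
    and total: "(\<Sum>k<m. y k) = (\<Sum>k<m. x k)" and l: "l \<le> m"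
  shows "(\<Sum>k<l. y k) \<le> (\<Sum>k<l. x k)"
proof (rule ccontr)
  assume less: "\<not> ?thesis"
  then obtain i where i: "i < l" "x i < y i"
    by (metis (no_types, lifting) lessThan_iff not_le sum_mono)
  have "x k \<le> y k" if "l \<le> k" "k < m" for k
    using x(1)[of i] x(2)[of k] y[of i k] i l that by auto
  then have "(\<Sum>k\<in>{l..<m}. x k) \<le> (\<Sum>k\<in>{l..<m}. y k)" by (intro sum_mono) auto
  moreover have "(\<Sum>k<m. g k) = (\<Sum>k<l. g k) + (\<Sum>k\<in>{l..<m}. g k)" for g :: "nat \<Rightarrow> int"
    using l by (metis atLeast0LessThan le0 sum.atLeastLessThan_concat)
  ultimately show False using less total by simp
qed

text \<open>
  For increasing lists with equal totals, a comparison of sums of largest entries is the reversed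
  comparison of the complementary prefix sums.
\<close>
lemma majorized_prefix_sums:
  assumes maj: "xs \<prec>\<^sub>M ys" and xs: "sorted xs" and ys: "sorted ys" and l: "l \<le> length xs"
  shows "sum_list (take l ys) \<le> sum_list (take l xs)"
proof -
  have len: "length xs = length ys" and total: "sum_list xs = sum_list ys"
    and major: "\<And>l. l \<le> length xs \<Longrightarrow> sum_list (take l (rev xs)) \<le> sum_list (take l (rev ys))"
    using maj xs ys unfolding majorized_def by (auto simp: sorted_sort_id)
  have tail: "sum_list (take (length zs - l) (rev zs)) = sum_list zs - sum_list (take l zs)"
    if "l \<le> length zs" for zs :: "real list"
  proof -
    have "sum_list zs = sum_list (take l zs) + sum_list (drop l zs)"
      by (metis append_take_drop_id sum_list_append)
    then show ?thesis using that by (simp add: take_rev)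
  qed
  show ?thesis using major[of "length xs - l"] tail[of xs] tail[of ys] l len total by simp
qed

section \<open>The matrix of a vector of group sizes\<close>

text \<open>
  The matrix \<open>I - b J\<close>, with \<open>J\<close> the all-ones matrix.
\<close>
definition shifted_identity :: "real \<Rightarrow> nat \<Rightarrow> nat \<Rightarrow> real" where
  "shifted_identity b i k = (if i = k then 1 else 0) - b"

text \<open>
  The matrix \<open>S diag(y) S\<close> with \<open>S = I - b J\<close>. It is linear in \<open>y\<close>, and since \<open>S\<close> commutes with
  permutations, permuting \<open>y\<close> only permutes rows and columns.
\<close>
definition size_form :: "nat \<Rightarrow> real \<Rightarrow> (nat \<Rightarrow> real) \<Rightarrow> nat \<Rightarrow> nat \<Rightarrow> real" where
  "size_form m b y i j = (\<Sum>k<m. shifted_identity b i k * y k * shifted_identity b k j)"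

lemma size_form_spectral:
  obtains u \<alpha> where "spectral_decomp m (size_form m b y) u \<alpha>"
proof (rule spectral_theorem)
  show "size_form m b y i j = size_form m b y j i" for i j
    unfolding size_form_def shifted_identity_def by (intro sum.cong) auto
qed (rule that)

lemma size_form_eigenvalue_nonneg:
  assumes L: "spectral_decomp m (size_form m b y) u \<alpha>" and y: "\<And>k. k < m \<Longrightarrow> 0 \<le> y k" and k: "k < m"
  shows "0 \<le> \<alpha> k"
proof -
  let ?S = "shifted_identity b"
  have "size_form m b y i j = (\<Sum>l<m. y l * (?S l i * ?S l j))" for i j
    unfolding size_form_def by (intro sum.cong refl) (simp add: shifted_identity_def)
  then have "\<alpha> k = (\<Sum>i<m. \<Sum>j<m. u k i * (\<Sum>l<m. y l * (?S l i * ?S l j)) * u k j)"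
    using spectral_decomp_eigenvalue[OF L k] by simp
  also have "\<dots> = (\<Sum>l<m. y l * (\<Sum>i<m. ?S l i * u k i)\<^sup>2)"
    by (rule quadratic_form_weighted_squares)
  also have "\<dots> \<ge> 0" using y by (intro sum_nonneg) auto
  finally show ?thesis .
qed

lemma size_form_permute:
  assumes \<sigma>: "bij_betw \<sigma> {..<m} {..<m}" and ij: "i < m" "j < m"
  shows "size_form m b (\<lambda>k. y (\<sigma> k)) i j = size_form m b y (\<sigma> i) (\<sigma> j)"
proof -
  have inj: "\<sigma> i = \<sigma> k \<longleftrightarrow> i = k" if "i < m" "k < m" for i k
    using \<sigma> that by (auto simp: bij_betw_def inj_on_def)
  have "size_form m b (\<lambda>k. y (\<sigma> k)) i j =
      (\<Sum>k<m. shifted_identity b (\<sigma> i) (\<sigma> k) * y (\<sigma> k) * shifted_identity b (\<sigma> k) (\<sigma> j))"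
    unfolding size_form_def by (intro sum.cong) (auto simp: shifted_identity_def inj ij)
  also have "\<dots> = size_form m b y (\<sigma> i) (\<sigma> j)"
    unfolding size_form_def
    by (rule sum.reindex_bij_betw[OF \<sigma>, of "\<lambda>k. shifted_identity b (\<sigma> i) k * y k * shifted_identity b k (\<sigma> j)"])
  finally show ?thesis .
qed

text \<open>
  The sum \<open>F y\<close> of \<open>f\<close> over the eigenvalues does not increase under mixing \<open>y\<close> with a transposed copy of
  itself, because the copy has the same eigenvalues; so \<open>F\<close> is monotone along the chain of transfers
  from \<open>y\<close> to \<open>x\<close>.
\<close>
lemma size_form_schur_convex:
  fixes f :: "real \<Rightarrow> real"
  assumes f: "convex_on {0..} f"
    and X: "spectral_decomp m (size_form m b x) u \<alpha>" and Y: "spectral_decomp m (size_form m b y) w \<beta>"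
    and x: "\<And>i j. i \<le> j \<Longrightarrow> j < m \<Longrightarrow> x i \<le> x j"
    and y: "\<And>k. k < m \<Longrightarrow> 0 \<le> y k" and tail: "\<And>k. m \<le> k \<Longrightarrow> x k = y k"
    and prefix: "\<And>l. l \<le> m \<Longrightarrow> (\<Sum>k<l. y k) \<le> (\<Sum>k<l. x k)"
    and total: "(\<Sum>k<m. y k) = (\<Sum>k<m. x k)"
  shows "(\<Sum>k<m. f (\<alpha> k)) \<le> (\<Sum>k<m. f (\<beta> k))"
proof -
  define F where "F y = (\<Sum>e\<in>#eigs m (size_form m b y). f e)" for y
  have F: "F y = (\<Sum>k<m. f (\<alpha> k))" if "spectral_decomp m (size_form m b y) u \<alpha>" for y u \<alpha>
    unfolding F_def eigs_spectral_decomp[OF that] by (simp add: multiset.map_comp sum_unfold_sum_mset comp_def)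
  have "F x \<le> F y"
  proof (rule majorization_by_transfers[where F = F and x = x and m = m])
    fix y :: "nat \<Rightarrow> real" and i j and s :: real
    assume y: "\<forall>k<m. 0 \<le> y k" and ij: "i < m" "j < m" and s: "0 \<le> s" "s \<le> 1"
    let ?t = "transpose i j"
    let ?z = "\<lambda>k. (1 - s) * y k + s * y (?t k)"
    have t: "bij_betw ?t {..<m} {..<m}"
      using ij by (intro bij_betw_byWitness[where f' = ?t]) (auto simp: transpose_def)
    obtain u \<alpha> where Y: "spectral_decomp m (size_form m b y) u \<alpha>" by (rule size_form_spectral)
    obtain w \<gamma> where Z: "spectral_decomp m (size_form m b ?z) w \<gamma>" by (rule size_form_spectral)
    have nonneg: "\<alpha> k \<in> {0..}" if "k < m" for k
      using size_form_eigenvalue_nonneg[OF Y _ that] y by auto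
    have mix: "size_form m b ?z i j =
        (1 - s) * size_form m b y i j + s * size_form m b y (?t i) (?t j)" if "i < m" "j < m" for i j
    proof -
      have "size_form m b ?z i j = (1 - s) * size_form m b y i j + s * size_form m b (\<lambda>k. y (?t k)) i j"
        unfolding size_form_def sum_distrib_left sum.distrib[symmetric]
        by (intro sum.cong) (auto simp: algebra_simps)
      then show ?thesis using size_form_permute[OF t that] by simp
    qed
    have "F ?z = (\<Sum>k<m. f (\<gamma> k))" by (rule F[OF Z])
    also have "\<dots> \<le> (1 - s) * (\<Sum>k<m. f (\<alpha> k)) + s * (\<Sum>k<m. f (\<alpha> k))"
      by (rule convex_sum_eigenvalues_mixture_le[OF Z Y spectral_decomp_permute[OF Y t] mix s f nonneg nonneg])
    also have "\<dots> = F y" unfolding F[OF Y] by (simp add: algebra_simps)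
    finally show "F ?z \<le> F y" .
  qed (use x y tail prefix total in auto)
  then show ?thesis using F[OF X] F[OF Y] by simp
qed

section \<open>Auxiliary sums and multisets\<close>

lemma image_mset_eq_mset_map:
  assumes "image_mset f M = mset ys"
  obtains xs where "mset xs = M" "map f xs = ys"
proof -
  have "\<exists>xs. mset xs = M \<and> map f xs = ys"
    using assms
  proof (induction ys arbitrary: M)
    case Nil
    then show ?case by simp
  next
    case (Cons y ys)
    then have "image_mset f M = add_mset y (mset ys)" by simp
    from msed_map_invR[OF this] obtain N x
      where N: "M = add_mset x N" "f x = y" "image_mset f N = mset ys" by blast
    obtain xs where "mset xs = N" "map f xs = ys" using Cons.IH[OF N(3)] by blast
    with N have "mset (x # xs) = M \<and> map f (x # xs) = y # ys" by simp
    then show ?case by (rule exI)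
  qed
  then show thesis using that by blast
qed

lemma sum_lessThan_double:
  "(\<Sum>j<2 * (n :: nat). g j) = (\<Sum>h<n. g (2 * h) + g (2 * h + 1) :: 'a :: comm_monoid_add)"
  by (induction n) (auto simp: add.assoc)

lemma sum_fibres:
  fixes f :: "nat \<Rightarrow> real" and r m :: nat
  assumes "\<And>h. h < r \<Longrightarrow> g h < m"
  shows "(\<Sum>h<r. f (g h)) = (\<Sum>i<m. real (card {h. h < r \<and> g h = i}) * f i)"
proof -
  have "(\<Sum>h<r. f (g h)) = (\<Sum>i<m. \<Sum>h\<in>{h \<in> {..<r}. g h = i}. f (g h))"
    using assms by (intro sum.group[symmetric]) auto
  also have "\<dots> = (\<Sum>i<m. real (card {h. h < r \<and> g h = i}) * f i)"
    by (intro sum.cong) auto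
  finally show ?thesis .
qed

section \<open>The eigenvalues of the information matrix\<close>

text \<open>
  The bound \<open>r < k1 + k2\<close> makes the order of the information matrix at least that of the Gram matrix of
  \<open>r\<close> deviation vectors and the all-ones vector, from which its eigenvalues are computed.
\<close>
locale design_parameters =
  fixes k1 k2 r :: nat
  assumes k_pos: "0 < k1" "0 < k2" and r_pos: "0 < r" and r_less: "r < k1 + k2"
begin

abbreviation "v \<equiv> k1 + k2"
abbreviation "\<gamma> \<equiv> gam k1 k2"
abbreviation "m \<equiv> n_gam k1 k2"

definition scale :: real where
  "scale = real v / (real k1 * real k2)"

text \<open>
  The least eigenvalue \<open>z\<^sub>d\<^sub>1\<close> of an E-optimal design.
\<close>
definition z_bound :: real where
  "z_bound = real r - 1 - \<gamma> * scale"

text \<open>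
  How far the overlaps fall short of their mean \<open>k1\<^sup>2 / v\<close>. The diagonal is set to \<open>\<gamma>\<close> because then the
  scaled Gram matrix of the deviations is an affine function of the whole deficit matrix.
\<close>
definition deficit :: "design \<Rightarrow> nat \<Rightarrow> nat \<Rightarrow> real" where
  "deficit d h h' = (if h = h' then \<gamma> else (real k1)\<^sup>2 / real v - real (phi d h h'))"

definition deviation :: "design \<Rightarrow> nat \<Rightarrow> nat \<Rightarrow> real" where
  "deviation d h i = (if i \<in> fst (d ! h) then 1 else 0) - real k1 / real v"

definition replicates :: "design \<Rightarrow> bool" where
  "replicates d \<longleftrightarrow> length d = r \<and> (\<forall>p\<in>set d. is_replicate k1 k2 p)"

lemma gam_bounds: "0 \<le> \<gamma>" "\<gamma> < 1"
  unfolding gam_def theta_bar_def by linarith+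

lemma scale_pos: "0 < scale"
  using k_pos unfolding scale_def by simp

lemma n_gam_bound: "1 \<le> m" "real m * (1 - \<gamma>) \<le> 1"
proof -
  have "1 \<le> 1 / (1 - \<gamma>)" using gam_bounds by simp
  then have fl: "1 \<le> \<lfloor>1 / (1 - \<gamma>)\<rfloor>" by linarith
  then show "1 \<le> m" unfolding n_gam_def by linarith
  have "real m \<le> 1 / (1 - \<gamma>)" using fl unfolding n_gam_def by linarith
  then show "real m * (1 - \<gamma>) \<le> 1" using gam_bounds by (simp add: field_simps)
qed

lemma le_n_gam:
  assumes "real n * (1 - \<gamma>) \<le> 1"
  shows "n \<le> m"
proof -
  have "real n \<le> 1 / (1 - \<gamma>)" using assms gam_bounds by (simp add: field_simps)
  then show ?thesis unfolding n_gam_def by linarith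
qed

lemma mean_overlap: "(real k1)\<^sup>2 / real v = of_int (theta_bar k1 k2) + \<gamma>"
  unfolding gam_def by simp

lemma replicatesD:
  assumes "replicates d" "h < r"
  shows "fst (d ! h) \<subseteq> {..<v}" "card (fst (d ! h)) = k1" "snd (d ! h) = {..<v} - fst (d ! h)"
  using assms unfolding replicates_def is_replicate_def by (metis Un_upper1 nth_mem,
    metis nth_mem, metis Diff_cancel Diff_disjoint Un_Diff Un_Diff_Int inf_commute nth_mem sup_bot_left Diff_triv)

text \<open>
  A replicate contributes \<open>1 / k1\<close> to the pairs inside its first block, \<open>1 / k2\<close> to the pairs inside its
  second block, and nothing to the other pairs; in each case this is \<open>1 / v\<close> plus \<open>scale\<close> times the
  product of the two deviations.
\<close>
lemma info_mat_entries:
  assumes d: "replicates d"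
  shows "info_mat k1 k2 d = mat v v (\<lambda>(i,j). real r * (if i = j then 1 else 0) +
    (-1) * (real r / real v + scale * (\<Sum>h<r. deviation d h i * deviation d h j)))"
proof -
  let ?D = "\<lambda>j. if even j then real k1 else real k2"
  let ?E = "\<lambda>j. if even j then 1 / real k1 else 1 / real k2"
  let ?N = "incidence_mat v d"
  have len: "length d = r" using d unfolding replicates_def by simp
  have DE: "mat_diag (2 * r) ?D * mat_diag (2 * r) ?E = 1\<^sub>m (2 * r)"
    and ED: "mat_diag (2 * r) ?E * mat_diag (2 * r) ?D = 1\<^sub>m (2 * r)"
  proof -
    have DE: "(\<lambda>j. ?D j * ?E j) = (\<lambda>_. 1)" and ED: "(\<lambda>j. ?E j * ?D j) = (\<lambda>_. 1)"
      using k_pos by auto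
    show "mat_diag (2 * r) ?D * mat_diag (2 * r) ?E = 1\<^sub>m (2 * r)"
      unfolding mat_diag_diag by (subst DE) (rule mat_diag_one)
    show "mat_diag (2 * r) ?E * mat_diag (2 * r) ?D = 1\<^sub>m (2 * r)"
      unfolding mat_diag_diag by (subst ED) (rule mat_diag_one)
  qed
  have inv: "the (mat_inverse (block_size_mat k1 k2 r)) = mat_diag (2 * r) ?E"
  proof -
    have dim: "block_size_mat k1 k2 r \<in> carrier_mat (2 * r) (2 * r)"
      unfolding block_size_mat_def by simp
    have "block_size_mat k1 k2 r \<in> Units (ring_mat TYPE(real) (2 * r) ())"
      using DE ED unfolding block_size_mat_def Units_def ring_mat_def
      by (auto intro!: bexI[of _ "mat_diag (2 * r) ?E"])
    then obtain B where B: "mat_inverse (block_size_mat k1 k2 r) = Some B"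
      using mat_inverse(1)[OF dim, of "()"] by blast
    from mat_inverse(2)[OF dim B]
    have BD: "B * mat_diag (2 * r) ?D = 1\<^sub>m (2 * r)" and cB: "B \<in> carrier_mat (2 * r) (2 * r)"
      unfolding block_size_mat_def by auto
    have "B = B * (mat_diag (2 * r) ?D * mat_diag (2 * r) ?E)"
      unfolding DE using cB by simp
    also have "\<dots> = (B * mat_diag (2 * r) ?D) * mat_diag (2 * r) ?E"
      by (rule assoc_mult_mat[symmetric, OF cB mat_diag_dim mat_diag_dim])
    also have "\<dots> = mat_diag (2 * r) ?E"
      unfolding BD by (rule left_mult_one_mat[OF mat_diag_dim])
    finally have "B = mat_diag (2 * r) ?E" .
    then show ?thesis using B by simp
  qed
  have N: "?N \<in> carrier_mat v (2 * r)" unfolding incidence_mat_def len by simp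
  have entry: "(?N * mat_diag (2 * r) ?E * transpose_mat ?N) $$ (i,j) =
      real r / real v + scale * (\<Sum>h<r. deviation d h i * deviation d h j)"
    if ij: "i < v" "j < v" for i j
  proof -
    have "(?N * mat_diag (2 * r) ?E * transpose_mat ?N) $$ (i,j) =
        (\<Sum>l<2 * r. ?N $$ (i,l) * ?E l * ?N $$ (j,l))"
      unfolding mat_diag_mult_right[OF N] using ij N
      by (simp add: scalar_prod_def atLeast0LessThan)
    also have "\<dots> = (\<Sum>h<r. ?N $$ (i,2*h) * ?E (2*h) * ?N $$ (j,2*h) +
        ?N $$ (i,2*h+1) * ?E (2*h+1) * ?N $$ (j,2*h+1))"
      by (rule sum_lessThan_double)
    also have "\<dots> = (\<Sum>h<r. 1 / real v + scale * (deviation d h i * deviation d h j))"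
    proof (rule sum.cong)
      fix h assume "h \<in> {..<r}"
      then have h: "h < r" by simp
      note b = replicatesD(3)[OF d h]
      define x where "x = (if i \<in> fst (d ! h) then 1 else 0 :: real)"
      define y where "y = (if j \<in> fst (d ! h) then 1 else 0 :: real)"
      have N0: "?N $$ (i,2*h) = x" "?N $$ (j,2*h) = y"
        "?N $$ (i,2*h+1) = 1 - x" "?N $$ (j,2*h+1) = 1 - y"
        using ij h b unfolding incidence_mat_def len x_def y_def block_def by auto
      have K: "real k1 \<noteq> 0" "real k2 \<noteq> 0" "real k1 + real k2 \<noteq> 0" using k_pos by auto
      have "x * (1 / real k1) * y + (1 - x) * (1 / real k2) * (1 - y) =
          1 / real v + scale * ((x - real k1 / real v) * (y - real k1 / real v))"
        using K unfolding scale_def by (simp add: divide_simps) (simp add: algebra_simps)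
      then show "?N $$ (i,2*h) * ?E (2*h) * ?N $$ (j,2*h) +
          ?N $$ (i,2*h+1) * ?E (2*h+1) * ?N $$ (j,2*h+1) =
          1 / real v + scale * (deviation d h i * deviation d h j)"
        unfolding N0 deviation_def x_def[symmetric] y_def[symmetric] by simp
    qed simp
    also have "\<dots> = real r / real v + scale * (\<Sum>h<r. deviation d h i * deviation d h j)"
      by (simp add: sum.distrib sum_distrib_left)
    finally show ?thesis .
  qed
  \<comment> \<open>The incidence product is kept opaque here, as its entries are already known.\<close>
  have aux: "real r \<cdot>\<^sub>m 1\<^sub>m v - K = mat v v (\<lambda>(i,j). real r * (if i = j then 1 else 0) + (-1) * B i j)"
    if "K \<in> carrier_mat v v" "\<And>i j. i < v \<Longrightarrow> j < v \<Longrightarrow> K $$ (i,j) = B i j" for K B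
    using that by (intro eq_matI) auto
  have "?N * mat_diag (2 * r) ?E * transpose_mat ?N \<in> carrier_mat v v"
    using N by (intro mult_carrier_mat) auto
  then show ?thesis unfolding info_mat_def len inv by (rule aux) (rule entry)
qed

lemma deviation_sum:
  assumes "replicates d" "h < r"
  shows "(\<Sum>i<v. deviation d h i) = 0"
proof -
  note R = replicatesD[OF assms]
  have "(\<Sum>i<v. if i \<in> fst (d ! h) then 1 else 0 :: real) = real k1"
    using R by (simp add: sum.If_cases Int_absorb1)
  then show ?thesis using k_pos unfolding deviation_def by (simp add: sum_subtractf)
qed

text \<open>
  The inner product of two deviation vectors is the overlap minus \<open>k1\<^sup>2 / v\<close>. For \<open>h = h'\<close> it is
  \<open>k1 k2 / v = 1 / scale\<close>, so the scaled Gram matrix has unit diagonal.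
\<close>
lemma deviation_gram:
  assumes d: "replicates d" and h: "h < r" and h': "h' < r"
  shows "scale * (\<Sum>i<v. deviation d h i * deviation d h' i) =
    (1 + \<gamma> * scale) * (if h = h' then 1 else 0) + (- scale) * deficit d h h'"
proof -
  note R = replicatesD[OF d h] and R' = replicatesD[OF d h']
  let ?x = "\<lambda>h i. if i \<in> fst (d ! h) then 1 else 0 :: real"
  let ?p = "real k1 / real v"
  have s: "(\<Sum>i<v. ?x h i) = real k1" "(\<Sum>i<v. ?x h' i) = real k1"
    using R R' by (simp_all add: sum.If_cases Int_absorb1)
  have "(\<Sum>i<v. ?x h i * ?x h' i) = (\<Sum>i<v. if i \<in> fst (d ! h) \<inter> fst (d ! h') then 1 else 0)"
    by (intro sum.cong) auto
  also have "\<dots> = (\<Sum>i\<in>fst (d ! h) \<inter> fst (d ! h'). 1)"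
    using R by (intro sum.mono_neutral_cong_right) auto
  also have "\<dots> = real (phi d h h')" unfolding phi_def by simp
  finally have p: "(\<Sum>i<v. ?x h i * ?x h' i) = real (phi d h h')" .
  have "(\<Sum>i<v. deviation d h i * deviation d h' i) =
      (\<Sum>i<v. ?x h i * ?x h' i - ?p * ?x h i - ?p * ?x h' i + ?p * ?p)"
    unfolding deviation_def by (intro sum.cong) (auto simp: algebra_simps)
  also have "\<dots> = real (phi d h h') - ?p * real k1 - ?p * real k1 + real v * (?p * ?p)"
    unfolding sum.distrib sum_subtractf p sum_distrib_left[symmetric] s by simp
  also have "\<dots> = real (phi d h h') - (real k1)\<^sup>2 / real v"
  proof -
    have "x - K / V * K - K / V * K + V * (K / V * (K / V)) = x - K\<^sup>2 / V" if "V \<noteq> 0" for x K V :: real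
      using that by (simp add: field_simps power2_eq_square)
    then show ?thesis using k_pos by (simp add: power2_eq_square)
  qed
  finally have gram: "(\<Sum>i<v. deviation d h i * deviation d h' i) =
      real (phi d h h') - (real k1)\<^sup>2 / real v" .
  show ?thesis
  proof (cases "h = h'")
    case True
    have K: "real k1 \<noteq> 0" "real k2 \<noteq> 0" "real k1 + real k2 \<noteq> 0" using k_pos by auto
    have "scale * (real k1 - (real k1)\<^sup>2 / real v) = 1"
      using K unfolding scale_def by (simp add: divide_simps) (simp add: algebra_simps power2_eq_square)
    moreover have "real (phi d h h') = real k1" using R True by (simp add: phi_def)
    ultimately show ?thesis unfolding gram deficit_def using True by simp
  next
    case False
    then show ?thesis unfolding gram deficit_def by (simp add: algebra_simps)
  qed
qed

lemma deficit_spectral: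
  obtains u q where "spectral_decomp r (deficit d) u q"
proof (rule spectral_theorem)
  show "deficit d i j = deficit d j i" for i j
    unfolding deficit_def phi_def by (simp add: Int_commute)
qed (rule that)

text \<open>
  The matrix subtracted from \<open>r I\<close> is \<open>Z Z\<^sup>T\<close>, where \<open>Z\<close> consists of the scaled deviations and one
  constant column. Deviations sum to \<open>0\<close>, so \<open>Z\<^sup>T Z\<close> is block diagonal: the Gram matrix of the deviations
  and the number \<open>r\<close>. The latter gives the eigenvalue \<open>0\<close> of the information matrix, and the zeros
  gained by swapping the factors give the eigenvalues \<open>r\<close>.
\<close>
lemma eigs_info_mat:
  assumes d: "replicates d" and Q: "spectral_decomp r (deficit d) u q"
  shows "proots (char_poly (info_mat k1 k2 d)) =
    image_mset (\<lambda>k. z_bound + scale * q k) (mset_set {..<r}) + {#0#} + replicate_mset (v - 1 - r) (real r)"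
proof -
  define Z where "Z i k = (if k < r then sqrt scale * deviation d k i else sqrt (real r / real v))" for i k :: nat
  define G where "G k l = (\<Sum>i<v. Z i k * Z i l)" for k l
  define B where "B i j = real r / real v + scale * (\<Sum>h<r. deviation d h i * deviation d h j)" for i j
  have BZ: "B = (\<lambda>i j. \<Sum>k<Suc r. Z i k * Z j k)"
  proof (intro ext)
    fix i j
    have "(\<Sum>k<r. Z i k * Z j k) = (\<Sum>k<r. scale * (deviation d k i * deviation d k j))"
    proof (rule sum.cong)
      fix k assume "k \<in> {..<r}"
      then have "Z i k * Z j k = (sqrt scale * sqrt scale) * (deviation d k i * deviation d k j)"
        unfolding Z_def by simp
      then show "Z i k * Z j k = scale * (deviation d k i * deviation d k j)" using scale_pos by simp
    qed simp
    then show "B i j = (\<Sum>k<Suc r. Z i k * Z j k)"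
      unfolding B_def by (simp add: sum_distrib_left) (simp add: Z_def)
  qed
  have G: "G k l = (1 + \<gamma> * scale) * (if k = l then 1 else 0) + (- scale) * deficit d k l"
    if "k < r" "l < r" for k l
  proof -
    have "G k l = (\<Sum>i<v. (sqrt scale * sqrt scale) * (deviation d k i * deviation d l i))"
      unfolding G_def Z_def using that by (intro sum.cong) auto
    also have "\<dots> = scale * (\<Sum>i<v. deviation d k i * deviation d l i)"
      using scale_pos by (simp add: sum_distrib_left)
    finally show ?thesis using deviation_gram[OF d that] by simp
  qed
  have G0: "G k r = 0" "G r k = 0" if "k < r" for k
    unfolding G_def Z_def using that deviation_sum[OF d that]
    by (simp_all flip: sum_distrib_left sum_distrib_right)
  have Gr: "G r r = real r" unfolding G_def Z_def using k_pos by simp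
  \<comment> \<open>Eigenvectors of \<open>G\<close>: those of the deficit matrix, extended by \<open>0\<close>, and the last unit vector.\<close>
  define U where "U k i = (if k < r \<and> i < r then u k i else if k = i then 1 else 0)" for k i
  define \<mu> where "\<mu> k = (if k < r then (1 + \<gamma> * scale) + (- scale) * q k else real r)" for k
  note Q' = spectral_decomp_affine[OF Q, of "1 + \<gamma> * scale" "- scale"]
  have "spectral_decomp (Suc r) G U \<mu>"
    unfolding spectral_decomp_def
  proof (intro conjI allI impI)
    fix k l assume "k < Suc r" "l < Suc r"
    then show "(\<Sum>i<Suc r. U k i * U l i) = (if k = l then 1 else 0)"
      using spectral_decomp_orthonormal[OF Q, of k l]
      by (cases "k < r"; cases "l < r") (auto simp: U_def less_Suc_eq)
  next
    fix i j assume "i < Suc r" "j < Suc r"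
    then show "G i j = (\<Sum>k<Suc r. \<mu> k * (U k i * U k j))"
      using Q'
      by (cases "i < r"; cases "j < r")
        (auto simp: U_def \<mu>_def less_Suc_eq G G0 Gr spectral_decomp_def)
  qed
  then have eG: "eigs (Suc r) G = image_mset \<mu> (mset_set {..<Suc r})"
    by (rule eigs_spectral_decomp)
  have eB: "eigs v B = image_mset \<mu> (mset_set {..<Suc r}) + replicate_mset (v - Suc r) 0"
    unfolding BZ using eigs_mult_swap[of "Suc r" v Z "\<lambda>k i. Z i k"] r_less eG
    unfolding G_def by simp
  have "B i j = B j i" for i j unfolding B_def by (simp add: mult.commute)
  then obtain W \<rho> where W: "spectral_decomp v B W \<rho>" using spectral_theorem[of v B] by blast
  note C = spectral_decomp_affine[OF W, of "real r" "-1"]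
  have info: "info_mat k1 k2 d = mat v v (\<lambda>(i,j). real r * (if i = j then 1 else 0) + (-1) * B i j)"
    unfolding info_mat_entries[OF d] B_def ..
  have "proots (char_poly (info_mat k1 k2 d)) = image_mset (\<lambda>x. real r + (-1) * x) (eigs v B)"
    unfolding info eigs_def[symmetric] eigs_spectral_decomp[OF C] eigs_spectral_decomp[OF W]
    by (simp add: multiset.map_comp comp_def)
  also have "\<dots> = image_mset (\<lambda>k. real r + (-1) * \<mu> k) (mset_set {..<r}) + {#0#} +
      replicate_mset (v - 1 - r) (real r)"
    unfolding eB by (simp add: multiset.map_comp comp_def lessThan_Suc) (simp add: \<mu>_def)
  also have "image_mset (\<lambda>k. real r + (-1) * \<mu> k) (mset_set {..<r}) =
      image_mset (\<lambda>k. z_bound + scale * q k) (mset_set {..<r})"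
    by (intro image_mset_cong) (auto simp: \<mu>_def z_bound_def)
  finally show "proots (char_poly (info_mat k1 k2 d)) =
    image_mset (\<lambda>k. z_bound + scale * q k) (mset_set {..<r}) + {#0#} + replicate_mset (v - 1 - r) (real r)" .
qed

text \<open>
  This number is \<open>r - \<mu> k\<close> for an eigenvalue \<open>\<mu> k\<close> of the scaled Gram matrix of the deviations. These
  eigenvalues are nonnegative and sum to the trace, which is \<open>r\<close>, so none of them exceeds \<open>r\<close>.
\<close>
lemma info_eigenvalue_nonneg:
  assumes d: "replicates d" and Q: "spectral_decomp r (deficit d) u q" and k: "k < r"
  shows "0 \<le> z_bound + scale * q k"
proof -
  define \<mu> where "\<mu> k = (1 + \<gamma> * scale) + (- scale) * q k" for k
  note M = spectral_decomp_affine[OF Q, of "1 + \<gamma> * scale" "- scale", folded \<mu>_def]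
  have \<mu>_nonneg: "0 \<le> \<mu> k" if k: "k < r" for k
  proof -
    have "\<mu> k = (\<Sum>i<r. \<Sum>j<r. u k i * (\<Sum>x<v. scale * (deviation d i x * deviation d j x)) * u k j)"
      unfolding spectral_decomp_eigenvalue[OF M k] sum_distrib_left[symmetric]
      by (intro sum.cong refl) (simp only: deviation_gram[OF d] lessThan_iff)
    also have "\<dots> = (\<Sum>x<v. scale * (\<Sum>i<r. deviation d i x * u k i)\<^sup>2)"
      by (rule quadratic_form_weighted_squares)
    also have "\<dots> \<ge> 0" using scale_pos by (intro sum_nonneg) auto
    finally show ?thesis .
  qed
  have "\<mu> k \<le> (\<Sum>k<r. \<mu> k)" using k \<mu>_nonneg by (intro member_le_sum) auto
  also have "\<dots> = real r" unfolding spectral_decomp_trace[OF M] deficit_def by simp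
  finally show ?thesis unfolding \<mu>_def z_bound_def by simp
qed

text \<open>
  The eigenvalues of the information matrix apart from the \<open>0\<close> of the all-ones vector.
\<close>
definition z_spectrum :: "(nat \<Rightarrow> real) \<Rightarrow> real multiset" where
  "z_spectrum q = image_mset (\<lambda>k. z_bound + scale * q k) (mset_set {..<r}) + replicate_mset (v - 1 - r) (real r)"

text \<open>
  Connectedness leaves room for only one zero eigenvalue, which the all-ones vector already takes.
\<close>
lemma info_eigenvalue_pos:
  assumes d: "d \<in> designs k1 k2 r" and Q: "spectral_decomp r (deficit d) u q" and k: "k < r"
  shows "0 < z_bound + scale * q k"
proof (rule ccontr)
  have rep: "replicates d" and con: "connected_design k1 k2 d"
    using d unfolding designs_def replicates_def by auto
  assume "\<not> ?thesis"
  then have zero: "z_bound + scale * q k = 0" using info_eigenvalue_nonneg[OF rep Q k] by simp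
  define C where "C i j = real r * (if i = j then 1 else 0) +
      (-1) * (real r / real v + scale * (\<Sum>h<r. deviation d h i * deviation d h j))" for i j
  have "C i j = C j i" for i j unfolding C_def by (simp add: mult.commute)
  then obtain U \<nu> where C: "spectral_decomp v C U \<nu>" using spectral_theorem[of v C] by blast
  have info: "info_mat k1 k2 d = mat v v (\<lambda>(i,j). C i j)"
    unfolding info_mat_entries[OF rep] C_def ..
  have "v - 1 \<le> card {k. k < v \<and> \<nu> k \<noteq> 0}"
    using rank_spectral_decomp_le[OF C] con unfolding connected_design_def info by simp
  moreover have "card ({k. k < v \<and> \<nu> k \<noteq> 0} \<union> {k. k < v \<and> \<nu> k = 0}) =
      card {k. k < v \<and> \<nu> k \<noteq> 0} + card {k. k < v \<and> \<nu> k = 0}"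
    by (rule card_Un_disjoint) auto
  moreover have "{k. k < v \<and> \<nu> k \<noteq> 0} \<union> {k. k < v \<and> \<nu> k = 0} = {..<v}" by auto
  then have "card ({k. k < v \<and> \<nu> k \<noteq> 0} \<union> {k. k < v \<and> \<nu> k = 0}) = v" by simp
  ultimately have le1: "card {k. k < v \<and> \<nu> k = 0} \<le> 1" by linarith
  have "image_mset \<nu> (mset_set {..<v}) = z_spectrum q + {#0#}"
    using eigs_info_mat[OF rep Q] eigs_spectral_decomp[OF C]
    unfolding z_spectrum_def info eigs_def by simp
  \<comment> \<open>The all-ones vector and index \<open>k\<close> would each account for a zero eigenvalue.\<close>
  then have "count (image_mset \<nu> (mset_set {..<v})) 0 = count (z_spectrum q) 0 + 1" by simp
  moreover have "0 \<in># z_spectrum q"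
    using k zero unfolding z_spectrum_def by (auto intro!: image_eqI[of _ _ k])
  moreover have "count (image_mset \<nu> (mset_set {..<v})) 0 = card {k. k < v \<and> \<nu> k = 0}"
    by (simp add: count_image_mset_eq_card_vimage)
  ultimately show False using le1 by (simp flip: count_greater_zero_iff)
qed

lemma nonzero_eigenvalues:
  assumes d: "d \<in> designs k1 k2 r" and Q: "spectral_decomp r (deficit d) u q"
  shows "filter_mset (\<lambda>x. x \<noteq> 0) (proots (char_poly (info_mat k1 k2 d))) = z_spectrum q"
    and "size (z_spectrum q) = v - 1"
proof -
  have rep: "replicates d" using d unfolding designs_def replicates_def by auto
  have "x \<noteq> 0" if "x \<in># z_spectrum q" for x
  proof -
    have "x = real r \<or> (\<exists>k<r. x = z_bound + scale * q k)"
      using that unfolding z_spectrum_def by (auto split: if_splits)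
    then show ?thesis
    proof
      assume "\<exists>k<r. x = z_bound + scale * q k"
      then obtain k where k: "k < r" "x = z_bound + scale * q k" by blast
      show ?thesis using info_eigenvalue_pos[OF d Q k(1)] k(2) by simp
    qed (use r_pos in simp)
  qed
  then have "filter_mset (\<lambda>x. x \<noteq> 0) (z_spectrum q) = z_spectrum q"
    by (simp add: filter_mset_eq_conv)
  then show "filter_mset (\<lambda>x. x \<noteq> 0) (proots (char_poly (info_mat k1 k2 d))) = z_spectrum q"
    unfolding eigs_info_mat[OF rep Q] z_spectrum_def by simp
  show "size (z_spectrum q) = v - 1" unfolding z_spectrum_def using r_less by simp
qed

lemma f_sum_eq:
  assumes d: "d \<in> designs k1 k2 r" and Q: "spectral_decomp r (deficit d) u q"
  shows "f_sum k1 k2 f d = (\<Sum>k<r. f (z_bound + scale * q k)) + real (v - 1 - r) * f (real r)"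
proof -
  let ?xs = "sorted_list_of_multiset (z_spectrum q)"
  have len: "length ?xs = v - 1"
    using nonzero_eigenvalues(2)[OF d Q] by (metis mset_sorted_list_of_multiset size_mset)
  have "f_sum k1 k2 f d = (\<Sum>i = 1..v - 1. f (?xs ! (i - 1)))"
    unfolding f_sum_def zval_def nonzero_eigenvalues(1)[OF d Q] ..
  also have "\<dots> = (\<Sum>i<v - 1. f (?xs ! i))"
    by (rule sum.reindex_bij_witness[of _ Suc "\<lambda>i. i - 1"]) auto
  also have "\<dots> = sum_list (map f ?xs)"
    unfolding sum_list_sum_nth using len by (simp add: atLeast0LessThan)
  also have "\<dots> = (\<Sum>x\<in>#z_spectrum q. f x)"
    by (metis mset_map mset_sorted_list_of_multiset sum_mset_sum_list)
  also have "\<dots> = (\<Sum>k<r. f (z_bound + scale * q k)) + real (v - 1 - r) * f (real r)"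
    unfolding z_spectrum_def by (simp add: multiset.map_comp comp_def sum_unfold_sum_mset)
  finally show ?thesis .
qed

lemma zval_least:
  assumes d: "d \<in> designs k1 k2 r" and Q: "spectral_decomp r (deficit d) u q"
  shows "t \<le> zval k1 k2 d 1 \<longleftrightarrow> (\<forall>x\<in>#z_spectrum q. t \<le> x)"
proof -
  let ?xs = "sorted_list_of_multiset (z_spectrum q)"
  have "length ?xs = v - 1"
    using nonzero_eigenvalues(2)[OF d Q] by (metis mset_sorted_list_of_multiset size_mset)
  then have ne: "0 < length ?xs" using r_pos r_less by simp
  have z: "zval k1 k2 d 1 = ?xs ! 0"
    unfolding zval_def nonzero_eigenvalues(1)[OF d Q] by simp
  have set: "set ?xs = set_mset (z_spectrum q)" by simp
  have "?xs ! 0 \<le> x" if "x \<in># z_spectrum q" for x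
  proof -
    obtain i where "i < length ?xs" "x = ?xs ! i" using \<open>x \<in># z_spectrum q\<close> set by (metis in_set_conv_nth)
    then show ?thesis using sorted_nth_mono[OF sorted_sorted_list_of_multiset, of 0 i "z_spectrum q"] by simp
  qed
  moreover have "?xs ! 0 \<in># z_spectrum q" using nth_mem[OF ne] set by simp
  ultimately show ?thesis unfolding z by (auto intro: order_trans)
qed

text \<open>
  Every eigenvalue apart from the trivial one is some \<open>z_bound + scale * q k\<close> or \<open>r \<ge> z_bound\<close>, so the
  comparison is decided by the signs of the \<open>q k\<close>.
\<close>
lemma zval_ge_bound_iff:
  assumes d: "d \<in> designs k1 k2 r" and Q: "spectral_decomp r (deficit d) u q"
  shows "z_bound \<le> zval k1 k2 d 1 \<longleftrightarrow> psd r (deficit d)"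
proof -
  have "0 \<le> \<gamma> * scale" using gam_bounds scale_pos by simp
  then have "z_bound \<le> real r" unfolding z_bound_def by linarith
  then have "(\<forall>x\<in>#z_spectrum q. z_bound \<le> x) \<longleftrightarrow> (\<forall>k<r. 0 \<le> q k)"
    using scale_pos unfolding z_spectrum_def by (auto simp: zero_le_mult_iff)
  then show ?thesis unfolding zval_least[OF d Q] psd_iff_eigenvalues_nonneg[OF Q] .
qed

section \<open>Positive semidefinite deficit matrices and group-affine designs\<close>

lemma deficit_off_diagonal:
  "h \<noteq> h' \<Longrightarrow> deficit d h h' = \<gamma> - real_of_int (int (phi d h h') - theta_bar k1 k2)"
  unfolding deficit_def mean_overlap by simp

lemma deficit_diagonal: "deficit d h h = \<gamma>"
  unfolding deficit_def by simp

lemma deficit_sym: "deficit d h h' = deficit d h' h"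
  unfolding deficit_def phi_def by (simp add: Int_commute)

text \<open>
  The form on the sum and on the difference of two unit vectors gives \<open>\<bar>\<gamma> - x\<bar> \<le> \<gamma> < 1\<close> for the
  integer \<open>x = \<phi> - \<theta>\<close>.
\<close>
lemma psd_deficit_overlap:
  assumes psd: "psd r (deficit d)" and h: "h < r" "h' < r" "h \<noteq> h'"
  shows "int (phi d h h') = theta_bar k1 k2 \<or> int (phi d h h') = theta_bar k1 k2 + 1"
proof -
  let ?x = "int (phi d h h') - theta_bar k1 k2"
  have T: "finite {h, h'}" "{h, h'} \<subseteq> {..<r}" using h by auto
  have "0 \<le> 2 * \<gamma> + 2 * deficit d h h'"
    using psd_minor[OF psd T, of "\<lambda>_. 1"] h by (simp add: deficit_diagonal deficit_sym[of d h' h])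
  moreover have "0 \<le> 2 * \<gamma> - 2 * deficit d h h'"
    using psd_minor[OF psd T, of "\<lambda>i. if i = h then 1 else -1"] h
    by (simp add: deficit_diagonal deficit_sym[of d h' h])
  ultimately have "0 \<le> real_of_int ?x" "real_of_int ?x < 2"
    using deficit_off_diagonal[OF h(3), of d] gam_bounds by linarith+
  then show ?thesis by linarith
qed

text \<open>
  If the excess of \<open>h\<close> and \<open>j\<close> were \<open>1\<close>, the form would take the value \<open>\<gamma> - 2 < 0\<close> on
  \<open>e\<^sub>h - e\<^sub>i + e\<^sub>j\<close>.
\<close>
lemma psd_deficit_transitive:
  assumes psd: "psd r (deficit d)" and h: "h < r" "i < r" "j < r"
    and hi: "int (phi d h i) = theta_bar k1 k2" and ij: "int (phi d i j) = theta_bar k1 k2"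
    and hj: "h \<noteq> j"
  shows "int (phi d h j) = theta_bar k1 k2"
proof (cases "h = i \<or> i = j")
  case False
  show ?thesis
  proof (rule ccontr)
    assume "int (phi d h j) \<noteq> theta_bar k1 k2"
    then have Q: "deficit d h j = \<gamma> - 1"
      using psd_deficit_overlap[OF psd h(1,3) hj] deficit_off_diagonal[OF hj, of d] by simp
    have Q': "deficit d h i = \<gamma>" "deficit d i j = \<gamma>"
      using deficit_off_diagonal[of h i d] deficit_off_diagonal[of i j d] hi ij False by simp_all
    have T: "finite {h, i, j}" "{h, i, j} \<subseteq> {..<r}" using h by auto
    show False
      using psd_minor[OF psd T, of "\<lambda>x. if x = i then -1 else 1"] False hj gam_bounds
      by (simp add: deficit_diagonal deficit_sym[of d i h] deficit_sym[of d j] Q Q')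
  qed
qed (use hi ij in auto)

text \<open>
  The groups are the classes of the relation "equal, or overlap \<open>\<theta>\<close>". On the sum of unit vectors of \<open>n\<close>
  representatives, the form is \<open>n (1 - n (1 - \<gamma>))\<close>, so it is nonnegative only if \<open>n (1 - \<gamma>) \<le> 1\<close>.
\<close>
lemma psd_deficit_group_affine:
  assumes len: "length d = r" and psd: "psd r (deficit d)"
  shows "\<exists>ts. group_affine k1 k2 d ts \<and> length ts \<le> m"
proof -
  define R where "R = {(h, h'). h < r \<and> h' < r \<and> (h = h' \<or> int (phi d h h') = theta_bar k1 k2)}"
  define P where "P = {..<r} // R"
  have "refl_on {..<r} R" "R \<subseteq> {..<r} \<times> {..<r}" unfolding R_def refl_on_def by auto
  moreover have "sym R" unfolding R_def sym_def phi_def by (auto simp: Int_commute)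
  moreover have "trans R"
  proof (rule transI)
    fix h i j assume "(h, i) \<in> R" "(i, j) \<in> R"
    then show "(h, j) \<in> R"
      using psd_deficit_transitive[OF psd, of h i j] unfolding R_def by auto
  qed
  ultimately have eq: "equiv {..<r} R" by (simp add: equiv_def)
  have part: "partition_on {..<r} P" unfolding P_def by (rule partition_on_quotient[OF eq])
  have same: "(\<exists>G\<in>P. h \<in> G \<and> h' \<in> G) \<longleftrightarrow> (h, h') \<in> R" if "h < r" "h' < r" for h h'
  proof
    assume "\<exists>G\<in>P. h \<in> G \<and> h' \<in> G"
    then show "(h, h') \<in> R" unfolding P_def using quotient_eq_iff[OF eq] by (metis quotient_disj)
  next
    assume "(h, h') \<in> R"
    then show "\<exists>G\<in>P. h \<in> G \<and> h' \<in> G"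
      using that equiv_class_self[OF eq, of h] unfolding P_def
      by (intro bexI[of _ "R `` {h}"]) (auto intro: quotientI)
  qed
  have "int (phi d h h') = (if \<exists>G\<in>P. h \<in> G \<and> h' \<in> G then theta_bar k1 k2 else theta_bar k1 k2 + 1)"
    if "h < r" "h' < r" "h \<noteq> h'" for h h'
    unfolding same[OF that(1,2)] using psd_deficit_overlap[OF psd that] that unfolding R_def by auto
  then have affine: "affine_partition k1 k2 d P"
    unfolding affine_partition_def len using part by blast
  have finP: "finite P" using finite_elements[OF _ part] by simp
  define ts where "ts = sorted_list_of_multiset (image_mset card (mset_set P))"
  have "mset ts = image_mset card (mset_set P)" unfolding ts_def by simp
  then have ga: "group_affine k1 k2 d ts"
    unfolding group_affine_def using affine by (auto simp: ts_def)
  have len_ts: "length ts = card P"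
    using \<open>mset ts = _\<close> by (metis size_image_mset size_mset size_mset_set)
  define rep where "rep G = (SOME h. h \<in> G)" for G :: "nat set"
  have rep: "rep G \<in> G" if "G \<in> P" for G
    unfolding rep_def using partition_onD3[OF part] that by (metis some_in_eq)
  have rep_r: "rep G < r" if "G \<in> P" for G
  proof -
    have "rep G \<in> \<Union>P" using rep[OF that] that by (rule UnionI[rotated])
    then show ?thesis by (simp only: partition_onD1[OF part, symmetric] lessThan_iff)
  qed
  have diff: "(rep G, rep H) \<notin> R" if GH: "G \<in> P" "H \<in> P" "G \<noteq> H" for G H
  proof
    assume "(rep G, rep H) \<in> R"
    then obtain K where "K \<in> P" "rep G \<in> K" "rep H \<in> K"
      using same[OF rep_r[OF GH(1)] rep_r[OF GH(2)]] by blast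
    then show False
      using rep[OF GH(1)] rep[OF GH(2)] GH partition_onD2[OF part] by (auto dest: disjointD)
  qed
  have inj: "inj_on rep P"
    using diff rep_r unfolding inj_on_def R_def by blast
  define n where "n = card P"
  have "0 \<le> (\<Sum>h\<in>rep ` P. \<Sum>h'\<in>rep ` P. 1 * deficit d h h' * 1)"
    using rep_r finP by (intro psd_minor[OF psd]) auto
  also have "\<dots> = (\<Sum>G\<in>P. \<Sum>H\<in>P. deficit d (rep G) (rep H))"
    by (simp add: sum.reindex[OF inj])
  also have "\<dots> = (\<Sum>G\<in>P. \<Sum>H\<in>P. (if G = H then 1 else 0) - (1 - \<gamma>))"
  proof (intro sum.cong refl)
    fix G H assume GH: "G \<in> P" "H \<in> P"
    show "deficit d (rep G) (rep H) = (if G = H then 1 else 0) - (1 - \<gamma>)"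
    proof (cases "G = H")
      case False
      note D = diff[OF GH False]
      then have ne: "rep G \<noteq> rep H" using rep_r GH unfolding R_def by auto
      have "int (phi d (rep G) (rep H)) = theta_bar k1 k2 + 1"
        using psd_deficit_overlap[OF psd rep_r[OF GH(1)] rep_r[OF GH(2)] ne] D rep_r GH
        unfolding R_def by auto
      then show ?thesis using False deficit_off_diagonal[OF ne, of d] by simp
    qed (simp add: deficit_diagonal)
  qed
  also have "\<dots> = real n * (1 - real n * (1 - \<gamma>))"
    using finP by (simp add: sum_subtractf n_def algebra_simps)
  finally have "real n * (1 - \<gamma>) \<le> 1"
    by (cases "n = 0") (auto simp: zero_le_mult_iff)
  then show ?thesis using ga len_ts le_n_gam unfolding n_def by auto
qed

text \<open>
  A nonzero vector with nonpositive form exists in both cases that semidefiniteness leaves: if some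
  overlap is \<open>\<theta>\<close>, the difference of the two unit vectors has form \<open>0\<close>; if all overlaps are
  \<open>\<theta> + 1\<close>, the all-ones vector has form \<open>r (1 - r (1 - \<gamma>))\<close>, and this is where the bound on \<open>\<gamma>\<close> enters.
\<close>
lemma deficit_not_positive_definite:
  assumes Q: "spectral_decomp r (deficit d) u q" and \<gamma>: "\<gamma> \<le> (real r - 1) / real r"
  shows "\<exists>k<r. q k \<le> 0"
proof (rule ccontr)
  assume "\<not> ?thesis"
  then have pos: "\<And>k. k < r \<Longrightarrow> 0 < q k" by force
  then have psd: "psd r (deficit d)" using psd_iff_eigenvalues_nonneg[OF Q] by force
  obtain y h0 where h0: "h0 < r" "y h0 \<noteq> (0::real)"
    and y: "(\<Sum>i<r. \<Sum>j<r. y i * deficit d i j * y j) \<le> 0"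
  proof (cases "\<exists>h<r. \<exists>h'<r. h \<noteq> h' \<and> int (phi d h h') = theta_bar k1 k2")
    case True
    then obtain h h' where h: "h < r" "h' < r" "h \<noteq> h'" "int (phi d h h') = theta_bar k1 k2" by blast
    let ?y = "\<lambda>i. if i = h then 1 else if i = h' then -1 else 0 :: real"
    have "deficit d h h' = \<gamma>" using h deficit_off_diagonal[OF h(3), of d] by simp
    then have "(\<Sum>i\<in>{h, h'}. \<Sum>j\<in>{h, h'}. ?y i * deficit d i j * ?y j) = 0"
      using h by (simp add: deficit_diagonal deficit_sym[of d h' h])
    moreover have "(\<Sum>i<r. \<Sum>j<r. ?y i * deficit d i j * ?y j) =
        (\<Sum>i\<in>{h, h'}. \<Sum>j\<in>{h, h'}. ?y i * deficit d i j * ?y j)"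
      using h by (intro quadratic_form_restrict) auto
    ultimately show thesis using that[of h ?y] h by simp
  next
    case False
    have "deficit d i j = (if i = j then 1 else 0) - (1 - \<gamma>)" if "i < r" "j < r" for i j
    proof (cases "i = j")
      case ij: False
      then have "int (phi d i j) = theta_bar k1 k2 + 1"
        using psd_deficit_overlap[OF psd that ij] False that by blast
      then show ?thesis using ij deficit_off_diagonal[OF ij, of d] by simp
    qed (simp add: deficit_diagonal)
    then have "(\<Sum>i<r. \<Sum>j<r. 1 * deficit d i j * 1) = (\<Sum>i<r. \<Sum>j<r. (if i = j then 1 else 0) - (1 - \<gamma>))"
      by (intro sum.cong) auto
    also have "\<dots> = real r * (1 - real r * (1 - \<gamma>))" by (simp add: sum_subtractf algebra_simps)
    also have "\<dots> \<le> 0"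
    proof -
      have "1 \<le> real r * (1 - \<gamma>)" using \<gamma> r_pos by (simp add: field_simps)
      then show ?thesis by (simp add: mult_nonneg_nonpos)
    qed
    finally show thesis using that[of 0 "\<lambda>_. 1"] r_pos by simp
  qed
  have "(\<Sum>k<r. q k * (\<Sum>i<r. u k i * y i)\<^sup>2) \<le> 0"
    using y unfolding spectral_decomp_quadratic_form[OF Q] .
  moreover have nn: "0 \<le> q k * (\<Sum>i<r. u k i * y i)\<^sup>2" if "k < r" for k
    using pos[OF that] by simp
  ultimately have "(\<Sum>k<r. q k * (\<Sum>i<r. u k i * y i)\<^sup>2) = 0"
    by (intro antisym sum_nonneg) auto
  then have "q k * (\<Sum>i<r. u k i * y i)\<^sup>2 = 0" if "k < r" for k
    using nn that by (subst (asm) sum_nonneg_eq_0_iff) auto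
  then have "(\<Sum>k<r. (\<Sum>i<r. u k i * y i)\<^sup>2) = 0"
    using pos by (intro sum.neutral) (metis lessThan_iff mult_eq_0_iff less_irrefl)
  then have "(\<Sum>i<r. (y i)\<^sup>2) = 0" unfolding spectral_decomp_parseval[OF Q] .
  then show False using h0 by (subst (asm) sum_nonneg_eq_0_iff) auto
qed

section \<open>Group sizes determine the eigenvalues\<close>

text \<open>
  The map \<open>g\<close> numbers the groups in the order of \<open>t_vec\<close>, the padding zeros being empty groups. It
  replaces the set partition by a function into \<open>{..<m}\<close>, so that sums over replicates become sums
  weighted by group sizes.
\<close>
lemma group_affine_t_vec:
  assumes len: "length d = r" and ga: "group_affine k1 k2 d ts" and n: "length ts \<le> m"
  shows "length (t_vec k1 k2 d) = m" "sorted (t_vec k1 k2 d)" "\<forall>t\<in>set (t_vec k1 k2 d). 0 \<le> t"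
    and "\<exists>g. (\<forall>h<r. g h < m) \<and> (\<forall>i<m. t_vec k1 k2 d ! i = int (card {h. h < r \<and> g h = i})) \<and>
      (\<forall>h<r. \<forall>h'<r. deficit d h h' = (if g h = g h' then 1 else 0) - (1 - \<gamma>))"
proof -
  have tv: "t_vec k1 k2 d = replicate (m - length ts) 0 @ map int ts"
    unfolding t_vec_def group_sizes_eq[OF ga] ..
  show "length (t_vec k1 k2 d) = m" unfolding tv using n by simp
  have st: "sorted ts" using ga unfolding group_affine_def by simp
  then have "sorted (map int ts)" by (simp add: sorted_map)
  then show "sorted (t_vec k1 k2 d)" unfolding tv by (auto simp: sorted_append)
  show "\<forall>t\<in>set (t_vec k1 k2 d). 0 \<le> t" unfolding tv by auto
  obtain P where aff: "affine_partition k1 k2 d P" and ms: "mset ts = image_mset card (mset_set P)"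
    using ga unfolding group_affine_def by blast
  have part: "partition_on {..<r} P" using aff len unfolding affine_partition_def by simp
  have finP: "finite P" using finite_elements[OF _ part] by simp
  obtain Gs where Gs: "mset Gs = mset_set P" "map card Gs = ts"
    using image_mset_eq_mset_map[OF ms[symmetric]] .
  have setGs: "set Gs = P" using Gs(1) finP by (metis finite_set_mset_mset_set set_mset_mset)
  have dist: "distinct Gs"
    unfolding distinct_count_atmost_1 Gs(1) setGs using finP by simp
  define k where "k = m - length ts"
  define Hs where "Hs = replicate k {} @ Gs"
  have lenGs: "length Gs = length ts" using Gs(2) by (metis length_map)
  have lenHs: "length Hs = m" unfolding Hs_def k_def using n lenGs by simp
  have tvH: "t_vec k1 k2 d = map (\<lambda>G. int (card G)) Hs"
    unfolding tv Hs_def k_def Gs(2)[symmetric] by simp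
  \<comment> \<open>The padding groups are empty, so a common element puts both indices into the part \<open>Gs\<close>.\<close>
  have uniq: "i = j" if "i < m" "j < m" "h \<in> Hs ! i" "h \<in> Hs ! j" for h i j
  proof -
    have ki: "k \<le> i" "k \<le> j" using that unfolding Hs_def by (auto simp: nth_append not_less[symmetric])
    then have H: "Hs ! i = Gs ! (i - k)" "Hs ! j = Gs ! (j - k)" unfolding Hs_def by (auto simp: nth_append)
    have l: "i - k < length Gs" "j - k < length Gs" using ki that lenHs unfolding Hs_def by auto
    then have "Gs ! (i - k) \<in> P" "Gs ! (j - k) \<in> P" using setGs nth_mem by blast+
    then have "Gs ! (i - k) = Gs ! (j - k)"
      using that(3,4) partition_onD2[OF part] unfolding H by (auto dest: disjointD)
    then show ?thesis using dist l ki by (simp add: nth_eq_iff_index_eq)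
  qed
  have ex: "\<exists>i<m. h \<in> Hs ! i" if "h < r" for h
  proof -
    have "h \<in> \<Union>P" using that by (simp only: partition_onD1[OF part, symmetric] lessThan_iff)
    then obtain G where "G \<in> P" "h \<in> G" by (rule UnionE)
    then have "G \<in> set Hs" unfolding Hs_def using setGs by simp
    then show ?thesis using \<open>h \<in> G\<close> lenHs by (metis in_set_conv_nth)
  qed
  define g where "g h = (SOME i. i < m \<and> h \<in> Hs ! i)" for h
  have g: "g h < m" "h \<in> Hs ! g h" if "h < r" for h
    using someI_ex[OF ex[OF that, unfolded Bex_def]] unfolding g_def by auto
  have sub: "Hs ! i \<subseteq> {..<r}" if "i < m" for i
  proof -
    have "Hs ! i \<in> insert {} P" using that lenHs setGs unfolding Hs_def
      by (metis UnE insertCI in_set_replicate nth_mem set_append)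
    then have "Hs ! i \<subseteq> \<Union>P" by auto
    then show ?thesis by (simp only: partition_onD1[OF part, symmetric])
  qed
  have fibre: "{h. h < r \<and> g h = i} = Hs ! i" if "i < m" for i
    using sub[OF that] g uniq that by blast
  have same: "(\<exists>G\<in>P. h \<in> G \<and> h' \<in> G) \<longleftrightarrow> g h = g h'" if "h < r" "h' < r" for h h'
  proof
    assume "\<exists>G\<in>P. h \<in> G \<and> h' \<in> G"
    then obtain G where "G \<in> set Hs" "h \<in> G" "h' \<in> G" unfolding Hs_def setGs[symmetric] by auto
    then obtain i where "i < m" "h \<in> Hs ! i" "h' \<in> Hs ! i" using lenHs by (metis in_set_conv_nth)
    then show "g h = g h'" using uniq g that by metis
  next
    assume eq: "g h = g h'"
    have "Hs ! g h \<in> set Hs" using g(1)[OF that(1)] lenHs by simp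
    then have "Hs ! g h \<in> P" using g(2)[OF that(1)] setGs unfolding Hs_def by auto
    then show "\<exists>G\<in>P. h \<in> G \<and> h' \<in> G" using g(2)[OF that(1)] g(2)[OF that(2)] eq by auto
  qed
  have "deficit d h h' = (if g h = g h' then 1 else 0) - (1 - \<gamma>)" if hh: "h < r" "h' < r" for h h'
  proof (cases "h = h'")
    case False
    have "int (phi d h h') = (if g h = g h' then theta_bar k1 k2 else theta_bar k1 k2 + 1)"
      using aff hh False same[OF hh] unfolding affine_partition_def len by simp
    then show ?thesis using deficit_off_diagonal[OF False, of d] by auto
  qed (simp add: deficit_diagonal)
  moreover have "t_vec k1 k2 d ! i = int (card {h. h < r \<and> g h = i})" if "i < m" for i
    unfolding fibre[OF that] tvH using that lenHs by simp
  ultimately show "\<exists>g. (\<forall>h<r. g h < m) \<and> (\<forall>i<m. t_vec k1 k2 d ! i = int (card {h. h < r \<and> g h = i})) \<and>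
      (\<forall>h<r. \<forall>h'<r. deficit d h h' = (if g h = g h' then 1 else 0) - (1 - \<gamma>))"
    using g by blast
qed

text \<open>
  The root of \<open>m b\<^sup>2 - 2 b = - (1 - \<gamma>)\<close> for which \<open>(I - b J)\<^sup>2 = I - (1 - \<gamma>) J\<close>; it is real because
  \<open>m (1 - \<gamma>) \<le> 1\<close>.
\<close>
definition root_shift :: real where
  "root_shift = (1 - sqrt (1 - real m * (1 - \<gamma>))) / real m"

abbreviation "S \<equiv> shifted_identity root_shift"

lemma shifted_identity_square:
  assumes ij: "i < m" "j < m"
  shows "(\<Sum>k<m. S i k * S k j) = (if i = j then 1 else 0) - (1 - \<gamma>)"
proof -
  let ?b = root_shift
  define s where "s = sqrt (1 - real m * (1 - \<gamma>))"
  have s2: "s * s = 1 - real m * (1 - \<gamma>)" using n_gam_bound(2) unfolding s_def by simp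
  have m: "real m \<noteq> 0" using n_gam_bound(1) by simp
  have b: "?b = (1 - s) / real m" unfolding root_shift_def s_def ..
  have "real m * (real m * ?b * ?b - 2 * ?b) = (1 - s) * (1 - s) - 2 * (1 - s)"
    unfolding b using m by (simp add: field_simps)
  also have "\<dots> = s * s - 1" by (simp add: algebra_simps)
  also have "\<dots> = real m * (- (1 - \<gamma>))" unfolding s2 by (simp add: algebra_simps)
  finally have bb: "real m * ?b * ?b - 2 * ?b = - (1 - \<gamma>)" using m by (metis mult_cancel_left)
  have "(\<Sum>k<m. S i k * S k j) =
      (\<Sum>k<m. (if i = k then (if i = j then 1 else 0) - ?b else 0) - (if k = j then ?b else 0) + ?b * ?b)"
    unfolding shifted_identity_def by (intro sum.cong) (auto simp: algebra_simps)
  also have "\<dots> = (if i = j then 1 else 0) + (real m * ?b * ?b - 2 * ?b)"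
    using ij by (simp add: sum.distrib sum_subtractf)
  finally show ?thesis unfolding bb by simp
qed

text \<open>
  The value \<open>0\<close> beyond index \<open>m\<close> makes two designs with the same group sizes have equal functions.
\<close>
definition size_of :: "design \<Rightarrow> nat \<Rightarrow> real" where
  "size_of d i = (if i < m then real_of_int (t_vec k1 k2 d ! i) else 0)"

lemma size_of_tail: "m \<le> i \<Longrightarrow> size_of d i = 0"
  unfolding size_of_def by simp

text \<open>
  The entry of \<open>Q\<close> at \<open>h, h'\<close> is the entry of \<open>S\<^sup>2\<close> at the groups of \<open>h\<close> and \<open>h'\<close>. Hence \<open>Q\<close> is a
  product of an \<open>r \<times> m\<close> with an \<open>m \<times> r\<close> matrix, and the product in the other order collects equal
  groups into \<open>S diag(t) S\<close>.
\<close>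
lemma group_affine_spectrum:
  assumes len: "length d = r" and ga: "group_affine k1 k2 d ts" and n: "length ts \<le> m" and mr: "m \<le> r"
    and L: "spectral_decomp m (size_form m root_shift (size_of d)) w \<alpha>"
    and Q: "spectral_decomp r (deficit d) u q"
  shows "image_mset q (mset_set {..<r}) = image_mset \<alpha> (mset_set {..<m}) + replicate_mset (r - m) 0"
    and "(\<Sum>i<m. size_of d i) = real r"
proof -
  obtain g where g: "\<And>h. h < r \<Longrightarrow> g h < m"
    and t: "\<And>i. i < m \<Longrightarrow> t_vec k1 k2 d ! i = int (card {h. h < r \<and> g h = i})"
    and D: "\<And>h h'. h < r \<Longrightarrow> h' < r \<Longrightarrow> deficit d h h' = (if g h = g h' then 1 else 0) - (1 - \<gamma>)"
    using group_affine_t_vec(4)[OF len ga n] by blast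
  have size: "size_of d i = real (card {h. h < r \<and> g h = i})" if "i < m" for i
    using t[OF that] that unfolding size_of_def by simp
  show "(\<Sum>i<m. size_of d i) = real r"
    using sum_fibres[OF g, where f = "\<lambda>_. 1"] size by simp
  have "eigs r (deficit d) = eigs r (\<lambda>h h'. \<Sum>k<m. S (g h) k * S k (g h'))"
    by (intro eigs_cong) (simp add: D shifted_identity_square g)
  also have "\<dots> = eigs m (\<lambda>k l. \<Sum>h<r. S k (g h) * S (g h) l) + replicate_mset (r - m) 0"
    by (rule eigs_mult_swap[OF mr])
  also have "eigs m (\<lambda>k l. \<Sum>h<r. S k (g h) * S (g h) l) = eigs m (size_form m root_shift (size_of d))"
  proof (intro eigs_cong)
    fix k l assume "k < m" "l < m"
    have "(\<Sum>h<r. S k (g h) * S (g h) l) = (\<Sum>i<m. real (card {h. h < r \<and> g h = i}) * (S k i * S i l))"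
      by (rule sum_fibres[OF g])
    then show "(\<Sum>h<r. S k (g h) * S (g h) l) = size_form m root_shift (size_of d) k l"
      unfolding size_form_def by (simp add: size mult_ac)
  qed
  finally show "image_mset q (mset_set {..<r}) = image_mset \<alpha> (mset_set {..<m}) + replicate_mset (r - m) 0"
    unfolding eigs_spectral_decomp[OF L] eigs_spectral_decomp[OF Q] .
qed

text \<open>
  Both traces reduce, by cyclic rearrangement, to the entries of \<open>S\<^sup>2\<close>, which are \<open>\<gamma>\<close> on the diagonal
  and \<open>\<gamma> - 1\<close> off it; the coefficient \<open>2 \<gamma> - 1\<close> is \<open>\<gamma>\<^sup>2 - (1 - \<gamma>)\<^sup>2\<close>.
\<close>
lemma size_form_traces:
  assumes L: "spectral_decomp m (size_form m root_shift t) w \<alpha>"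
  shows "(\<Sum>k<m. \<alpha> k) = \<gamma> * (\<Sum>k<m. t k)"
    and "(\<Sum>k<m. (\<alpha> k)\<^sup>2) = (2 * \<gamma> - 1) * (\<Sum>k<m. (t k)\<^sup>2) + (1 - \<gamma>)\<^sup>2 * (\<Sum>k<m. t k)\<^sup>2"
proof -
  have "(\<Sum>k<m. \<alpha> k) = (\<Sum>i<m. \<Sum>k<m. S i k * t k * S k i)"
    unfolding spectral_decomp_trace[OF L] size_form_def ..
  also have "\<dots> = (\<Sum>k<m. \<Sum>i<m. S i k * t k * S k i)" by (rule sum.swap)
  also have "\<dots> = (\<Sum>k<m. t k * (\<Sum>i<m. S k i * S i k))"
    by (simp add: sum_distrib_left mult_ac)
  also have "\<dots> = \<gamma> * (\<Sum>k<m. t k)"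
    by (simp add: shifted_identity_square sum_distrib_left mult.commute)
  finally show "(\<Sum>k<m. \<alpha> k) = \<gamma> * (\<Sum>k<m. t k)" .
  have "(\<Sum>k<m. (\<alpha> k)\<^sup>2) =
      (\<Sum>i<m. \<Sum>l<m. (\<Sum>k<m. S i k * t k * S k l) * (\<Sum>h<m. S l h * t h * S h i))"
    unfolding spectral_decomp_trace[OF spectral_decomp_square[OF L]] size_form_def ..
  also have "\<dots> = (\<Sum>i<m. \<Sum>l<m. \<Sum>k<m. \<Sum>h<m. t k * t h * (S k l * S l h) * (S h i * S i k))"
    by (simp add: sum_product mult_ac)
  also have "\<dots> = (\<Sum>i<m. \<Sum>k<m. \<Sum>l<m. \<Sum>h<m. t k * t h * (S k l * S l h) * (S h i * S i k))"
    by (intro sum.cong refl sum.swap)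
  also have "\<dots> = (\<Sum>i<m. \<Sum>k<m. \<Sum>h<m. \<Sum>l<m. t k * t h * (S k l * S l h) * (S h i * S i k))"
    by (intro sum.cong refl sum.swap)
  also have "\<dots> = (\<Sum>k<m. \<Sum>i<m. \<Sum>h<m. \<Sum>l<m. t k * t h * (S k l * S l h) * (S h i * S i k))"
    by (rule sum.swap)
  also have "\<dots> = (\<Sum>k<m. \<Sum>h<m. \<Sum>i<m. \<Sum>l<m. t k * t h * (S k l * S l h) * (S h i * S i k))"
    by (intro sum.cong refl sum.swap)
  also have "\<dots> = (\<Sum>k<m. \<Sum>h<m. t k * t h * (\<Sum>l<m. S k l * S l h) * (\<Sum>i<m. S h i * S i k))"
    by (simp only: sum_distrib_left sum_distrib_right)
  also have "\<dots> = (\<Sum>k<m. \<Sum>h<m. (if k = h then (2 * \<gamma> - 1) * (t k)\<^sup>2 else 0) + (1 - \<gamma>)\<^sup>2 * (t k * t h))"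
    by (intro sum.cong refl) (auto simp: shifted_identity_square power2_eq_square algebra_simps)
  also have "\<dots> = (2 * \<gamma> - 1) * (\<Sum>k<m. (t k)\<^sup>2) + (1 - \<gamma>)\<^sup>2 * (\<Sum>k<m. t k)\<^sup>2"
    by (simp add: sum.distrib sum_distrib_left[symmetric] power2_eq_square sum_product)
  finally show "(\<Sum>k<m. (\<alpha> k)\<^sup>2) = (2 * \<gamma> - 1) * (\<Sum>k<m. (t k)\<^sup>2) + (1 - \<gamma>)\<^sup>2 * (\<Sum>k<m. t k)\<^sup>2" .
qed

section \<open>Optimality\<close>

lemma n_gam_le_replicates:
  assumes "\<gamma> \<le> (real r - 1) / real r"
  shows "m \<le> r"
proof -
  have "1 \<le> real r * (1 - \<gamma>)" using assms r_pos by (simp add: field_simps)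
  then have "real m * (1 - \<gamma>) \<le> real r * (1 - \<gamma>)" using n_gam_bound(2) by linarith
  then show ?thesis using gam_bounds by simp
qed

definition affine_class :: "design set" where
  "affine_class = {d \<in> designs k1 k2 r. \<exists>ts. group_affine k1 k2 d ts \<and> length ts \<le> m}"

lemma size_of_affine:
  assumes "d \<in> affine_class"
  shows "length (t_vec k1 k2 d) = m" "sorted (t_vec k1 k2 d)"
    and "\<And>i j. i \<le> j \<Longrightarrow> j < m \<Longrightarrow> size_of d i \<le> size_of d j" and "\<And>k. 0 \<le> size_of d k"
proof -
  obtain ts where "length d = r" "group_affine k1 k2 d ts" "length ts \<le> m"
    using assms unfolding affine_class_def designs_def by blast
  note tv = group_affine_t_vec(1-3)[OF this]
  show "length (t_vec k1 k2 d) = m" "sorted (t_vec k1 k2 d)" by (fact tv)+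
  show "size_of d i \<le> size_of d j" if "i \<le> j" "j < m" for i j
    using that tv unfolding size_of_def by (simp add: sorted_nth_mono)
  show "0 \<le> size_of d k" for k
    using tv unfolding size_of_def by (simp add: nth_mem)
qed

text \<open>
  The positivity of \<open>z_bound\<close> makes the argument of \<open>f\<close> stay in its domain. It holds because some
  eigenvalue of the deficit matrix is nonpositive, whereas the eigenvalue of the connected design that
  belongs to it is positive.
\<close>
lemma affine_class_eigenvalues:
  assumes \<gamma>: "\<gamma> \<le> (real r - 1) / real r" and d: "d \<in> affine_class"
    and L: "spectral_decomp m (size_form m root_shift (size_of d)) w \<alpha>"
  shows "psd r (deficit d)" and "0 < z_bound" and "(\<Sum>i<m. size_of d i) = real r"
    and "f_sum k1 k2 f d = (\<Sum>k<m. f (z_bound + scale * \<alpha> k)) +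
      (real (r - m) * f z_bound + real (v - 1 - r) * f (real r))"
proof -
  obtain ts where des: "d \<in> designs k1 k2 r" and ts: "length d = r" "group_affine k1 k2 d ts" "length ts \<le> m"
    using d unfolding affine_class_def designs_def by blast
  obtain u q where Q: "spectral_decomp r (deficit d) u q" by (rule deficit_spectral)
  note spec = group_affine_spectrum[OF ts n_gam_le_replicates[OF \<gamma>] L Q]
  show "(\<Sum>i<m. size_of d i) = real r" by (rule spec(2))
  have "0 \<le> \<alpha> k" if "k < m" for k
    using size_form_eigenvalue_nonneg[OF L _ that] size_of_affine(4)[OF d] by blast
  moreover have "q ` {..<r} \<subseteq> insert 0 (\<alpha> ` {..<m})"
    using arg_cong[OF spec(1), of set_mset] by (auto split: if_splits)
  ultimately have "\<forall>k<r. 0 \<le> q k" by fastforce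
  then show "psd r (deficit d)" unfolding psd_iff_eigenvalues_nonneg[OF Q] .
  obtain k where k: "k < r" "q k \<le> 0" using deficit_not_positive_definite[OF Q \<gamma>] by blast
  have "scale * q k \<le> 0" using k(2) scale_pos by (simp add: mult_nonneg_nonpos)
  then show "0 < z_bound" using info_eigenvalue_pos[OF des Q k(1)] by linarith
  have "(\<Sum>k<r. f (z_bound + scale * q k)) =
      (\<Sum>x\<in>#image_mset q (mset_set {..<r}). f (z_bound + scale * x))"
    by (simp add: sum_unfold_sum_mset multiset.map_comp comp_def)
  also have "\<dots> = (\<Sum>k<m. f (z_bound + scale * \<alpha> k)) + real (r - m) * f z_bound"
    unfolding spec(1) by (simp add: sum_unfold_sum_mset multiset.map_comp comp_def)
  finally show "f_sum k1 k2 f d = (\<Sum>k<m. f (z_bound + scale * \<alpha> k)) +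
      (real (r - m) * f z_bound + real (v - 1 - r) * f (real r))"
    unfolding f_sum_eq[OF des Q] by simp
qed

text \<open>
  No design exceeds \<open>z_bound\<close>, and affine designs reach it. Once one affine design exists, an E-optimal
  design must reach it too, so its deficit matrix is positive semidefinite.
\<close>
lemma E_optimal_iff_affine:
  assumes \<gamma>: "\<gamma> \<le> (real r - 1) / real r" and ex: "affine_class \<noteq> {}"
  shows "E_optimal k1 k2 r d \<longleftrightarrow> d \<in> affine_class"
proof -
  have upper: "zval k1 k2 d 1 \<le> z_bound" if des: "d \<in> designs k1 k2 r" for d
  proof -
    obtain u q where Q: "spectral_decomp r (deficit d) u q" by (rule deficit_spectral)
    obtain k where k: "k < r" "q k \<le> 0" using deficit_not_positive_definite[OF Q \<gamma>] by blast
    have "z_bound + scale * q k \<in># z_spectrum q" using k unfolding z_spectrum_def by auto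
    then have "zval k1 k2 d 1 \<le> z_bound + scale * q k" using zval_least[OF des Q] by blast
    then show ?thesis using k(2) scale_pos mult_nonneg_nonpos[of scale "q k"] by linarith
  qed
  have attained: "z_bound \<le> zval k1 k2 d 1" if d: "d \<in> affine_class" for d
  proof -
    obtain u q where Q: "spectral_decomp r (deficit d) u q" by (rule deficit_spectral)
    obtain w \<alpha> where L: "spectral_decomp m (size_form m root_shift (size_of d)) w \<alpha>"
      by (rule size_form_spectral)
    have "d \<in> designs k1 k2 r" using d unfolding affine_class_def by simp
    then show ?thesis using zval_ge_bound_iff[OF _ Q] affine_class_eigenvalues(1)[OF \<gamma> d L] by simp
  qed
  show ?thesis
  proof
    assume E: "E_optimal k1 k2 r d"
    obtain d0 where d0: "d0 \<in> affine_class" using ex by blast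
    then have "d0 \<in> designs k1 k2 r" unfolding affine_class_def by simp
    then have "z_bound \<le> zval k1 k2 d 1" using attained[OF d0] E unfolding E_optimal_def by force
    moreover have des: "d \<in> designs k1 k2 r" using E unfolding E_optimal_def by simp
    moreover obtain u q where Q: "spectral_decomp r (deficit d) u q" by (rule deficit_spectral)
    ultimately have "psd r (deficit d)" using zval_ge_bound_iff by blast
    moreover have "length d = r" using des unfolding designs_def by simp
    ultimately show "d \<in> affine_class"
      using psd_deficit_group_affine des unfolding affine_class_def by simp
  next
    assume d: "d \<in> affine_class"
    then have "d \<in> designs k1 k2 r" unfolding affine_class_def by simp
    then show "E_optimal k1 k2 r d"
      unfolding E_optimal_def using attained[OF d] upper by force
  qed
qed

lemma f_sum_le_of_majorized:
  assumes \<gamma>: "\<gamma> \<le> (real r - 1) / real r" and d1: "d1 \<in> affine_class" and d2: "d2 \<in> affine_class"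
    and prefix: "\<And>l. l \<le> m \<Longrightarrow> (\<Sum>k<l. size_of d2 k) \<le> (\<Sum>k<l. size_of d1 k)"
    and f: "convex_on {0<..} f"
  shows "f_sum k1 k2 f d1 \<le> f_sum k1 k2 f d2"
proof -
  obtain w \<alpha> where L1: "spectral_decomp m (size_form m root_shift (size_of d1)) w \<alpha>"
    by (rule size_form_spectral)
  obtain u \<beta> where L2: "spectral_decomp m (size_form m root_shift (size_of d2)) u \<beta>"
    by (rule size_form_spectral)
  note e1 = affine_class_eigenvalues[OF \<gamma> d1 L1] and e2 = affine_class_eigenvalues[OF \<gamma> d2 L2]
  have conv: "convex_on {0..} (\<lambda>x. f (z_bound + scale * x))"
  proof (rule convex_onI)
    fix t x y :: real assume t: "0 < t" "t < 1" and xy: "x \<in> {0..}" "y \<in> {0..}"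
    have pos: "0 < z_bound + scale * x" "0 < z_bound + scale * y"
      using xy e1(2) scale_pos by (auto intro!: add_pos_nonneg)
    have "z_bound + scale * ((1 - t) *\<^sub>R x + t *\<^sub>R y) =
        (1 - t) *\<^sub>R (z_bound + scale * x) + t *\<^sub>R (z_bound + scale * y)"
      by (simp add: algebra_simps)
    then show "f (z_bound + scale * ((1 - t) *\<^sub>R x + t *\<^sub>R y)) \<le>
        (1 - t) * f (z_bound + scale * x) + t * f (z_bound + scale * y)"
      using convex_onD[OF f, of t "z_bound + scale * x" "z_bound + scale * y"] t pos by simp
  qed simp
  have "(\<Sum>k<m. f (z_bound + scale * \<alpha> k)) \<le> (\<Sum>k<m. f (z_bound + scale * \<beta> k))"
    by (rule size_form_schur_convex[OF conv L1 L2])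
      (use size_of_affine[OF d1] size_of_affine[OF d2] prefix e1(3) e2(3) in \<open>auto simp: size_of_tail\<close>)
  then show ?thesis unfolding e1(4) e2(4) by simp
qed

text \<open>
  Sizes that differ while having the same sum need \<open>m \<ge> 2\<close>, and then \<open>m (1 - \<gamma>) \<le> 1\<close> gives
  \<open>\<gamma> \<ge> 1 / 2\<close>. So \<open>2 \<gamma> - 1 > 0\<close>, and a smaller sum of squared sizes is a smaller sum of squared
  eigenvalues.
\<close>
lemma f_sum_square_less:
  assumes \<gamma>: "\<gamma> \<le> (real r - 1) / real r" and d1: "d1 \<in> affine_class" and d2: "d2 \<in> affine_class"
    and prefix: "\<And>l. l \<le> m \<Longrightarrow> (\<Sum>k<l. size_of d2 k) \<le> (\<Sum>k<l. size_of d1 k)"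
    and ne: "t_vec k1 k2 d1 \<noteq> t_vec k1 k2 d2" and half: "\<gamma> \<noteq> 1 / 2"
  shows "f_sum k1 k2 (\<lambda>x. x\<^sup>2) d1 < f_sum k1 k2 (\<lambda>x. x\<^sup>2) d2"
proof -
  obtain w \<alpha> where L1: "spectral_decomp m (size_form m root_shift (size_of d1)) w \<alpha>"
    by (rule size_form_spectral)
  obtain u \<beta> where L2: "spectral_decomp m (size_form m root_shift (size_of d2)) u \<beta>"
    by (rule size_form_spectral)
  note e1 = affine_class_eigenvalues[OF \<gamma> d1 L1] and e2 = affine_class_eigenvalues[OF \<gamma> d2 L2]
  have ne': "size_of d1 \<noteq> size_of d2"
  proof
    assume eq: "size_of d1 = size_of d2"
    have "t_vec k1 k2 d1 ! i = t_vec k1 k2 d2 ! i" if "i < m" for i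
      using fun_cong[OF eq, of i] that unfolding size_of_def by simp
    then show False
      using ne size_of_affine(1)[OF d1] size_of_affine(1)[OF d2] by (auto intro: nth_equalityI)
  qed
  have "1 < m"
  proof (rule ccontr)
    assume "\<not> 1 < m"
    then have "m = 1" using n_gam_bound(1) by simp
    then have "size_of d1 = size_of d2"
      using e1(3) e2(3) by (intro ext) (auto simp: size_of_def)
    then show False using ne' by simp
  qed
  then have "2 * (1 - \<gamma>) \<le> real m * (1 - \<gamma>)" using gam_bounds by (intro mult_right_mono) auto
  from order_trans[OF this n_gam_bound(2)] have "1 / 2 \<le> \<gamma>" by simp
  with half have "1 / 2 < \<gamma>" by (simp add: less_le)
  then have g: "0 < 2 * \<gamma> - 1" by simp
  have "(\<Sum>k<m. (size_of d1 k)\<^sup>2) < (\<Sum>k<m. (size_of d2 k)\<^sup>2)"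
    by (rule sum_squares_less_of_majorized[OF _ _ _ _ prefix _ ne'])
      (use size_of_affine[OF d1] size_of_affine[OF d2] e1(3) e2(3) in \<open>auto simp: size_of_tail\<close>)
  then have sq: "(\<Sum>k<m. (\<alpha> k)\<^sup>2) < (\<Sum>k<m. (\<beta> k)\<^sup>2)"
    unfolding size_form_traces(2)[OF L1] size_form_traces(2)[OF L2] e1(3) e2(3) using g by simp
  have lin: "(\<Sum>k<m. \<alpha> k) = (\<Sum>k<m. \<beta> k)"
    unfolding size_form_traces(1)[OF L1] size_form_traces(1)[OF L2] e1(3) e2(3) ..
  have expand: "(\<Sum>k<m. (z_bound + scale * g k)\<^sup>2) =
      real m * z_bound\<^sup>2 + 2 * z_bound * scale * (\<Sum>k<m. g k) + scale\<^sup>2 * (\<Sum>k<m. (g k)\<^sup>2)" for g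
    by (simp add: power2_sum power_mult_distrib sum.distrib sum_distrib_left mult_ac)
  show ?thesis
    unfolding e1(4) e2(4) expand lin using sq scale_pos by simp
qed

end

theorem theorem15:
  fixes k1 k2 r :: nat
  assumes "k2 \<ge> 2" and "k1 \<ge> k2" and "2 \<le> r" and "r \<le> k1 + k2 - 1"
    and "gam k1 k2 \<le> (real r - 1) / real r"
    and "\<exists>d\<in>designs k1 k2 r. \<exists>ts. group_affine k1 k2 d ts \<and> length ts \<le> n_gam k1 k2"
  shows "{d. E_optimal k1 k2 r d} =
           {d \<in> designs k1 k2 r. \<exists>ts. group_affine k1 k2 d ts \<and> length ts \<le> n_gam k1 k2} \<and>
         (\<forall>d1 d2. E_optimal k1 k2 r d1 \<and> E_optimal k1 k2 r d2 \<and>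
            map real_of_int (t_vec k1 k2 d1) \<prec>\<^sub>M map real_of_int (t_vec k1 k2 d2) \<longrightarrow>
              (\<forall>f. convex_on {0<..} f \<longrightarrow> f_sum k1 k2 f d1 \<le> f_sum k1 k2 f d2) \<and>
              (t_vec k1 k2 d1 \<noteq> t_vec k1 k2 d2 \<and> gam k1 k2 \<noteq> 1 / 2 \<longrightarrow>
                 schur_better k1 k2 d1 d2)) \<and>
         (\<forall>d. E_optimal k1 k2 r d \<and> uniform_sizes (group_sizes k1 k2 d) \<and>
            length (group_sizes k1 k2 d) = n_gam k1 k2 \<longrightarrow> E_schur_optimal k1 k2 r d)"
proof -
  interpret design_parameters k1 k2 r
    using assms by unfold_locales auto
  note \<gamma> = assms(5)
  have E: "E_optimal k1 k2 r d \<longleftrightarrow> d \<in> affine_class" for d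
    using E_optimal_iff_affine[OF \<gamma>] assms(6) unfolding affine_class_def by blast
  have size_sum: "(\<Sum>k<l. size_of d k) = sum_list (take l (map real_of_int (t_vec k1 k2 d)))"
    if "d \<in> affine_class" "l \<le> m" for d l
    unfolding sum_list_sum_nth using that size_of_affine(1)[OF that(1)]
    by (simp add: size_of_def atLeast0LessThan min_absorb2)
  have part_a: "(\<forall>f. convex_on {0<..} f \<longrightarrow> f_sum k1 k2 f d1 \<le> f_sum k1 k2 f d2) \<and>
      (t_vec k1 k2 d1 \<noteq> t_vec k1 k2 d2 \<and> \<gamma> \<noteq> 1 / 2 \<longrightarrow> schur_better k1 k2 d1 d2)"
    if d1: "d1 \<in> affine_class" and d2: "d2 \<in> affine_class"
      and maj: "map real_of_int (t_vec k1 k2 d1) \<prec>\<^sub>M map real_of_int (t_vec k1 k2 d2)" for d1 d2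
  proof -
    have sorted: "sorted (map real_of_int (t_vec k1 k2 d))" if "d \<in> affine_class" for d
      using size_of_affine(2)[OF that] by (simp add: sorted_map)
    have prefix: "(\<Sum>k<l. size_of d2 k) \<le> (\<Sum>k<l. size_of d1 k)" if "l \<le> m" for l
      unfolding size_sum[OF d1 that] size_sum[OF d2 that]
      using majorized_prefix_sums[OF maj sorted[OF d1] sorted[OF d2]] that size_of_affine(1)[OF d1] by simp
    note le = f_sum_le_of_majorized[OF \<gamma> d1 d2 prefix]
    have "convex_on {0<..} (\<lambda>x::real. x\<^sup>2)"
      using convex_power2 by (rule convex_on_subset) auto
    then show ?thesis
      unfolding schur_better_def using le f_sum_square_less[OF \<gamma> d1 d2 prefix] by blast
  qed
  have part_b: "f_sum k1 k2 f d \<le> f_sum k1 k2 f d'"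
    if d: "d \<in> affine_class" and uni: "uniform_sizes (group_sizes k1 k2 d)"
      and n: "length (group_sizes k1 k2 d) = m" and d': "d' \<in> affine_class" and f: "convex_on {0<..} f"
    for d d' f
  proof (rule f_sum_le_of_majorized[OF \<gamma> d d' _ f])
    fix l assume l: "l \<le> m"
    let ?t = "t_vec k1 k2 d" and ?t' = "t_vec k1 k2 d'"
    have tv: "?t = map int (group_sizes k1 k2 d)" unfolding t_vec_def using n by simp
    have "0 < m" using n_gam_bound(1) by simp
    then have last: "last (group_sizes k1 k2 d) = group_sizes k1 k2 d ! (m - 1)"
      and hd: "hd (group_sizes k1 k2 d) = group_sizes k1 k2 d ! 0"
      using n by (metis last_conv_nth list.size(3) less_irrefl, metis hd_conv_nth list.size(3) less_irrefl)
    have ends: "?t ! (m - 1) \<le> ?t ! 0 + 1"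
      using uni \<open>0 < m\<close> n unfolding uniform_sizes_def last hd tv by simp
    have mono: "?t ! i \<le> ?t ! j" if "i \<le> j" "j < m" for i j
      using sorted_nth_mono[OF size_of_affine(2)[OF d]] that size_of_affine(1)[OF d] by simp
    have mono': "?t' ! i \<le> ?t' ! j" if "i \<le> j" "j < m" for i j
      using sorted_nth_mono[OF size_of_affine(2)[OF d']] that size_of_affine(1)[OF d'] by simp
    have total: "(\<Sum>k<m. size_of d k) = (\<Sum>k<m. size_of d' k)"
      using affine_class_eigenvalues(3)[OF \<gamma> d] affine_class_eigenvalues(3)[OF \<gamma> d']
      by (metis size_form_spectral)
    have of_int: "(\<Sum>k<l. size_of d k) = real_of_int (\<Sum>k<l. t_vec k1 k2 d ! k)" if "l \<le> m" for l d
      using that unfolding size_of_def by simp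
    have "(\<Sum>k<l. ?t' ! k) \<le> (\<Sum>k<l. ?t ! k)"
    proof (rule uniform_prefix_sums_largest[OF _ _ mono' _ l])
      show "?t ! 0 \<le> ?t ! i" if "i < m" for i using mono[of 0 i] that by simp
      show "?t ! i \<le> ?t ! 0 + 1" if "i < m" for i proof -
        have "i \<le> m - 1" "m - 1 < m" using that by auto
        then show ?thesis using mono[of i "m - 1"] ends by linarith
      qed
      show "(\<Sum>k<m. ?t' ! k) = (\<Sum>k<m. ?t ! k)" using total unfolding of_int[OF order_refl] of_int_eq_iff by (rule sym)
    qed
    then show "(\<Sum>k<l. size_of d' k) \<le> (\<Sum>k<l. size_of d k)"
      unfolding of_int[OF l] by (simp only: of_int_le_iff)
  qed
  show ?thesis
    unfolding E_schur_optimal_def E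
    using part_a part_b unfolding affine_class_def by blast
qed

end
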